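(* Let $d\ge 1$, $T>0$, $R>0$, $r>0$, $M_\epsilon>0$, let $H$ be an RKHS of functions $\mathbb{R}^d\to\mathbb{R}^d$ with matrix-valued reproducing kernel $K$, and let $f_0\in H$. Assume: ($A_1$) there exist $f^*\in H$ with $\|f^*-f_0\|_H\le R$ and $x_0^*\in\mathbb{R}^d$ with $|x_0^*|\le r$ such that $x^*(0)=x_0^*$ and $\dot x^*(t)=f^*(x^*(t))$ for every $0\le t\le T$; ($A_2$) the observations are $y_j=x^*(t_j)+\epsilon_j\in\mathbb{R}^d$, $j=1,\dots,m$, where the noise variables $\epsilon_j$ are independent and bounded in absolute value by the constant $M_\epsilon$; ($A_3$) $K$ is of class $\mathcal{C}^2(\mathbb{R}^d)$ in its first argument (hence also in its second argument); ($A_4$) there is a constant $N_K$ such that $K_{ii}(u,u)-2K_{ii}(u,v)+K_{ii}(v,v)\le N_K^2|u-v|^2$ for all $u,v\in\mathbb{R}^d$ and $i=1,\dots,d$. Let $\hat x:[0,T]\to\mathbb{R}^d$ be the estimated trajectory computed from the observations at times $t_1<\dots<t_m$ with Euler step $h$, as defined in the context, and put $t_{m+1}=T$. Then there exist positive constants $K_1,K_2,K_3,K_4$, depending only on $R$, $r$, $T$, $M_\epsilon$, $N_K$ and the kernel $K$, such that for every $\epsilon>0$, with probability less than $$\exp\left(\frac{-K_2\epsilon^2}{d\sum_{j=1}^m (t_{j+1}-t_j)^2}\right),$$ one has $$\|\hat x-x^*\|_{L^2}^2\ \ge\ K_1 d\sqrt{\sum_{j=1}^m (t_{j+1}-t_j)^2}+h^2K_3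 d+K_4 d\sum_{j=1}^m (t_{j+1}-t_j)^2+\epsilon .$$
   Context: A vector-valued RKHS $H$ of functions $\mathbb{R}^d\to\mathbb{R}^d$ with reproducing kernel $K:\mathbb{R}^d\times\mathbb{R}^d\to\mathbb{R}^{d\times d}$ is a real Hilbert space of such functions for which $K(\cdot,x)v\in H$ and $v^Tf(x)=\langle f,K(\cdot,x)v\rangle_H$ for all $f\in H$, $x,v\in\mathbb{R}^d$. $K_{ii}$ denotes the $i$-th diagonal entry of $K$, $|\cdot|$ the Euclidean norm, and $\|g\|_{L^2}^2=\int_0^T|g(t)|^2dt$. Time grid: $s_l=lh$, $l=0,\dots,k$, with $kh=T$, is a regular grid of $[0,T]$. The observation times $0=t_1<\dots<t_m\le T$ lie on the grid: $t_j=s_{k_j}$ for integers $0=k_1<k_2<\dots<k_m$. By definition $t_{m+1}=T$. Estimated trajectory: let $(\hat z,\hat f)$, with $\hat z=(\hat z_0,\dots,\hat z_k)\in\mathbb{R}^{d(k+1)}$ and $\hat f\in H$, be a solution of $$\min_{z\in\mathbb{R}^{d(k+1)},\,f\in H}\ \sum_{j=1}^m (t_{j+1}-t_j)|y_j-z_{k_j}|^2$$ subject to $\|f-f_0\|_H\le R$, $|z_0|\le r$, and $z_{l+1}=z_l+hf(z_l)$ for $0\le l\le k-1$. Then $\hat x:[0,T]\to\mathbb{R}^d$ is the piecewise linear interpolation with $\hat x(s_l)=\hat z_l$, $0\le l\le k$.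
   Formalization: The noise variables are also assumed to have mean zero, and the constants may depend on an upper bound for the norm of f_0; without either change the claim is false. The constants are stated for probability spaces on one fixed, arbitrary type of sample points. *)

theory Defs
  imports "HOL-Probability.Probability"
begin

section \<open>Vector-valued reproducing kernel Hilbert spaces\<close>

text \<open>The Hilbert space is a carrier set \<open>H\<close> of functions with the pointwise vector space
  structure; the inner product \<open>ip\<close> is only meaningful on \<open>H\<close>.\<close>

definition hnorm :: "(('a \<Rightarrow> 'b) \<Rightarrow> ('a \<Rightarrow> 'b) \<Rightarrow> real) \<Rightarrow> ('a \<Rightarrow> 'b) \<Rightarrow> real" where
  "hnorm ip f = sqrt (ip f f)"

locale vector_rkhs =
  fixes H :: "(real^'n \<Rightarrow> real^'n) set"
    and ip :: "(real^'n \<Rightarrow> real^'n) \<Rightarrow> (real^'n \<Rightarrow> real^'n) \<Rightarrow> real"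
    and K :: "real^'n \<Rightarrow> real^'n \<Rightarrow> real^'n^'n"
  assumes zero_mem: "(\<lambda>x. 0) \<in> H"
    and add_mem: "f \<in> H \<Longrightarrow> g \<in> H \<Longrightarrow> (\<lambda>x. f x + g x) \<in> H"
    and scale_mem: "f \<in> H \<Longrightarrow> (\<lambda>x. c *\<^sub>R f x) \<in> H"
    and ip_sym: "f \<in> H \<Longrightarrow> g \<in> H \<Longrightarrow> ip f g = ip g f"
    and ip_add: "f \<in> H \<Longrightarrow> g \<in> H \<Longrightarrow> u \<in> H \<Longrightarrow> ip (\<lambda>x. f x + g x) u = ip f u + ip g u"
    and ip_scale: "f \<in> H \<Longrightarrow> g \<in> H \<Longrightarrow> ip (\<lambda>x. c *\<^sub>R f x) g = c * ip f g"
    and ip_nonneg: "f \<in> H \<Longrightarrow> 0 \<le> ip f f"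
    and ip_definite: "f \<in> H \<Longrightarrow> ip f f = 0 \<Longrightarrow> f = (\<lambda>x. 0)"
    and complete: "range F \<subseteq> H \<Longrightarrow>
      (\<forall>e>0. \<exists>N. \<forall>i\<ge>N. \<forall>j\<ge>N. hnorm ip (\<lambda>x. F i x - F j x) < e) \<Longrightarrow>
      \<exists>f\<in>H. (\<lambda>i. hnorm ip (\<lambda>x. F i x - f x)) \<longlonglongrightarrow> 0"
    and kernel_mem: "(\<lambda>u. K u x *v v) \<in> H"
    and reproducing: "f \<in> H \<Longrightarrow> v \<bullet> f x = ip f (\<lambda>u. K u x *v v)"

definition C2 :: "('a::real_normed_vector \<Rightarrow> 'b::real_normed_vector) \<Rightarrow> bool" where
  "C2 g \<longleftrightarrow> (\<exists>(g' :: 'a \<Rightarrow> 'a \<Rightarrow>\<^sub>L 'b) (g'' :: 'a \<Rightarrow> 'a \<Rightarrow>\<^sub>L ('a \<Rightarrow>\<^sub>L 'b)).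
     (\<forall>u. (g has_derivative blinfun_apply (g' u)) (at u)) \<and>
     (\<forall>u. (g' has_derivative blinfun_apply (g'' u)) (at u)) \<and>
     continuous_on UNIV g'')"

section \<open>The data\<close>

definition true_trajectory ::
  "(real^'n \<Rightarrow> real^'n) set \<Rightarrow> ((real^'n \<Rightarrow> real^'n) \<Rightarrow> (real^'n \<Rightarrow> real^'n) \<Rightarrow> real) \<Rightarrow>
   (real^'n \<Rightarrow> real^'n) \<Rightarrow> real \<Rightarrow> real \<Rightarrow> real \<Rightarrow> (real \<Rightarrow> real^'n) \<Rightarrow> bool" where
  "true_trajectory H ip f0 R r T xs \<longleftrightarrow>
     (\<exists>fs\<in>H. \<exists>x0. hnorm ip (\<lambda>u. fs u - f0 u) \<le> R \<and> norm x0 \<le> r \<and> xs 0 = x0 \<and>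
        (\<forall>t\<in>{0..T}. (xs has_vector_derivative fs (xs t)) (at t within {0..T})))"

text \<open>The grid points are \<open>l * h\<close> for \<open>l \<le> k\<close>; observation \<open>j \<in> {1..m}\<close> sits at grid index
  \<open>\<kappa> j\<close>, and \<open>t (Suc m)\<close> is the extra final time.\<close>

definition observation_grid ::
  "real \<Rightarrow> real \<Rightarrow> nat \<Rightarrow> nat \<Rightarrow> (nat \<Rightarrow> nat) \<Rightarrow> (nat \<Rightarrow> real) \<Rightarrow> bool" where
  "observation_grid T h k m \<kappa> t \<longleftrightarrow>
     real k * h = T \<and> 1 \<le> m \<and> \<kappa> 1 = 0 \<and> strict_mono_on {1..m} \<kappa> \<and> \<kappa> m \<le> k \<and>
     (\<forall>j\<in>{1..m}. t j = real (\<kappa> j) * h) \<and> t (Suc m) = T"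

text \<open>Noise is understood to be centred.\<close>

definition bounded_noise ::
  "'w measure \<Rightarrow> nat \<Rightarrow> real \<Rightarrow> (nat \<Rightarrow> 'w \<Rightarrow> real^'n) \<Rightarrow> bool" where
  "bounded_noise M m B \<epsilon> \<longleftrightarrow>
     prob_space M \<and> prob_space.indep_vars M (\<lambda>_. borel) \<epsilon> {1..m} \<and>
     (\<forall>j\<in>{1..m}. (AE \<omega> in M. norm (\<epsilon> j \<omega>) \<le> B) \<and> (LINT \<omega>|M. \<epsilon> j \<omega>) = 0)"

section \<open>The estimator\<close>

definition feasible ::
  "(real^'n \<Rightarrow> real^'n) set \<Rightarrow> ((real^'n \<Rightarrow> real^'n) \<Rightarrow> (real^'n \<Rightarrow> real^'n) \<Rightarrow> real) \<Rightarrow>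
   (real^'n \<Rightarrow> real^'n) \<Rightarrow> real \<Rightarrow> real \<Rightarrow> real \<Rightarrow> nat \<Rightarrow>
   (nat \<Rightarrow> real^'n) \<Rightarrow> (real^'n \<Rightarrow> real^'n) \<Rightarrow> bool" where
  "feasible H ip f0 R r h k z f \<longleftrightarrow>
     f \<in> H \<and> hnorm ip (\<lambda>u. f u - f0 u) \<le> R \<and> norm (z 0) \<le> r \<and>
     (\<forall>l<k. z (Suc l) = z l + h *\<^sub>R f (z l))"

definition loss ::
  "nat \<Rightarrow> (nat \<Rightarrow> nat) \<Rightarrow> (nat \<Rightarrow> real) \<Rightarrow> (nat \<Rightarrow> real^'n) \<Rightarrow> (nat \<Rightarrow> real^'n) \<Rightarrow> real" where
  "loss m \<kappa> t y z = (\<Sum>j=1..m. (t (Suc j) - t j) * (norm (y j - z (\<kappa> j)))\<^sup>2)"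

text \<open>Only \<open>z 0, \<dots>, z k\<close> matter in the following definition.\<close>

definition estimate ::
  "(real^'n \<Rightarrow> real^'n) set \<Rightarrow> ((real^'n \<Rightarrow> real^'n) \<Rightarrow> (real^'n \<Rightarrow> real^'n) \<Rightarrow> real) \<Rightarrow>
   (real^'n \<Rightarrow> real^'n) \<Rightarrow> real \<Rightarrow> real \<Rightarrow> real \<Rightarrow> nat \<Rightarrow> nat \<Rightarrow> (nat \<Rightarrow> nat) \<Rightarrow> (nat \<Rightarrow> real) \<Rightarrow>
   (nat \<Rightarrow> real^'n) \<Rightarrow> (nat \<Rightarrow> real^'n) \<Rightarrow> (real^'n \<Rightarrow> real^'n) \<Rightarrow> bool" where
  "estimate H ip f0 R r h k m \<kappa> t y z f \<longleftrightarrow>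
     is_arg_min (\<lambda>(z, f). loss m \<kappa> t y z) (\<lambda>(z, f). feasible H ip f0 R r h k z f) (z, f)"

definition interpolate :: "real \<Rightarrow> (nat \<Rightarrow> 'a::real_vector) \<Rightarrow> real \<Rightarrow> 'a" where
  "interpolate h z s =
     (let l = nat \<lfloor>s / h\<rfloor> in z l + ((s - real l * h) / h) *\<^sub>R (z (Suc l) - z l))"

lemma interpolate_grid: "h > 0 \<Longrightarrow> interpolate h z (real l * h) = z l"
  by (simp add: interpolate_def)

lemma interpolate_segment:
  assumes "h > 0" "0 \<le> a" "a \<le> 1"
  shows "interpolate h z ((real l + a) * h) = (1 - a) *\<^sub>R z l + a *\<^sub>R z (Suc l)"
proof (cases "a = 1")
  case True
  then show ?thesis
    using interpolate_grid[OF assms(1), of z "Suc l"] by (simp add: algebra_simps)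
next
  case False
  then have "\<lfloor>real l + a\<rfloor> = int l"
    using assms by (simp add: floor_unique)
  moreover have "(real l + a) * h / h = real l + a" and "((real l + a) * h - real l * h) / h = a"
    using assms(1) by (simp_all add: field_simps)
  ultimately show ?thesis
    by (simp add: interpolate_def scaleR_diff_left scaleR_diff_right)
qed

definition L2_norm_sq :: "real \<Rightarrow> (real \<Rightarrow> real^'n) \<Rightarrow> real" where
  "L2_norm_sq T g = (LINT s:{0..T}|lborel. (norm (g s))\<^sup>2)"

end

theory Submission
  imports Defs
begin

text \<open>
  Kernel functions of bounded norm are uniformly Lipschitz, so all Euler paths and the true trajectory
  are uniformly bounded and Lipschitz in time. Comparing the loss of \<open>z\<close> with that of the Euler path \<open>q\<close>
  of \<open>f\<^sup>*\<close>, which is within \<open>O(h)\<close> of \<open>x\<^sup>*\<close>, leaves the noise term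
  \<open>\<Sum>\<^sub>j w\<^sub>j \<epsilon>\<^sub>j \<bullet> (z - q)(t\<^sub>j)\<close>, where \<open>w\<^sub>j = t\<^sub>j\<^sub>+\<^sub>1 - t\<^sub>j\<close>. Instead of chaining over the class of paths, sum by
  parts: as \<open>z - q\<close> is Lipschitz, the noise term is at most a fixed weighted average of the norms of the
  partial sums of \<open>w\<^sub>j \<epsilon>\<^sub>j\<close>, whose exponential moments follow from Hoeffding's lemma and convexity. The
  factor 2 from the two tails is absorbed by the term with \<open>K\<^sub>1\<close>.
\<close>

section \<open>Functions of a vector-valued RKHS\<close>

context vector_rkhs
begin

section \<open>Hilbert space calculus on the carrier \<open>H\<close>\<close>

lemma diff_mem: "f \<in> H \<Longrightarrow> g \<in> H \<Longrightarrow> (\<lambda>x. f x - g x) \<in> H"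
  using add_mem[of f "\<lambda>x. (-1) *\<^sub>R g x"] scale_mem[of g "-1"] by simp

text \<open>Keeping \<open>c\<close> free lets one expansion serve for distances
  (\<open>c = -1\<close>), for the triangle inequality (\<open>c = 1\<close>) and for Cauchy-Schwarz
  (the minimising \<open>c\<close>).\<close>

lemma ip_add_scale_self:
  assumes f: "f \<in> H" and g: "g \<in> H"
  shows "ip (\<lambda>x. f x + c *\<^sub>R g x) (\<lambda>x. f x + c *\<^sub>R g x) = ip f f + 2 * c * ip f g + c\<^sup>2 * ip g g"
proof -
  note cg = scale_mem[OF g, of c]
  have "ip f (\<lambda>x. f x + c *\<^sub>R g x) = ip f f + c * ip f g"
    using ip_sym[OF f add_mem[OF f cg]] ip_add[OF f cg f] ip_scale[OF g f] ip_sym[OF f g] by simp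
  moreover have "ip g (\<lambda>x. f x + c *\<^sub>R g x) = ip f g + c * ip g g"
    using ip_sym[OF g add_mem[OF f cg]] ip_add[OF f cg g] ip_scale[OF g g] by simp
  ultimately show ?thesis
    using ip_add[OF f cg add_mem[OF f cg]] ip_scale[OF g add_mem[OF f cg]]
    by (simp add: power2_eq_square algebra_simps)
qed

lemma ip_diff_self:
  assumes "f \<in> H" "g \<in> H"
  shows "ip (\<lambda>x. f x - g x) (\<lambda>x. f x - g x) = ip f f - 2 * ip f g + ip g g"
  using ip_add_scale_self[OF assms, of "-1"] by simp

lemma ip_diff_right:
  assumes f: "f \<in> H" and g: "g \<in> H" and u: "u \<in> H"
  shows "ip f (\<lambda>x. g x - u x) = ip f g - ip f u"
  using ip_sym[OF f diff_mem[OF g u]] ip_add[OF g scale_mem[OF u, of "-1"] f]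
    ip_scale[OF u f, of "-1"] ip_sym[OF f g] ip_sym[OF f u]
  by simp

lemma hnorm_nonneg: "f \<in> H \<Longrightarrow> 0 \<le> hnorm ip f"
  by (simp add: hnorm_def ip_nonneg)

lemma hnorm_power2: "f \<in> H \<Longrightarrow> (hnorm ip f)\<^sup>2 = ip f f"
  by (simp add: hnorm_def ip_nonneg)

lemma ip_abs_le_hnorm:
  assumes f: "f \<in> H" and g: "g \<in> H"
  shows "\<bar>ip f g\<bar> \<le> hnorm ip f * hnorm ip g"
proof (cases "ip g g = 0")
  case True
  have "g = (\<lambda>x. 0)"
    by (rule ip_definite[OF g True])
  with ip_scale[OF g f, of 0] ip_sym[OF f g] have "ip f g = 0"
    by simp
  then show ?thesis
    using hnorm_nonneg[OF f] hnorm_nonneg[OF g] by simp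
next
  case False
  then have pos: "ip g g > 0"
    using ip_nonneg[OF g] by simp
  \<comment> \<open>The coefficient \<open>- ip f g / ip g g\<close> minimises the squared norm of
    \<open>f + c g\<close> over \<open>c\<close>; nonnegativity at the minimum is
    Cauchy-Schwarz.\<close>
  have "0 \<le> ip f f + 2 * (- ip f g / ip g g) * ip f g + (- ip f g / ip g g)\<^sup>2 * ip g g"
    unfolding ip_add_scale_self[OF f g, symmetric] by (intro ip_nonneg add_mem f scale_mem g)
  also have "\<dots> = ip f f - (ip f g)\<^sup>2 / ip g g"
    using pos by (simp add: power2_eq_square field_simps)
  finally have "(ip f g)\<^sup>2 \<le> ip f f * ip g g"
    using pos by (simp add: field_simps)
  then have "sqrt ((ip f g)\<^sup>2) \<le> sqrt (ip f f * ip g g)"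
    by (rule real_sqrt_le_mono)
  then show ?thesis
    by (simp add: hnorm_def real_sqrt_mult)
qed

lemma hnorm_triangle_diff:
  assumes f: "f \<in> H" and g: "g \<in> H"
  shows "hnorm ip f \<le> hnorm ip (\<lambda>x. f x - g x) + hnorm ip g"
proof (rule power2_le_imp_le)
  let ?u = "\<lambda>x. f x - g x"
  note u = diff_mem[OF f g]
  have "(hnorm ip f)\<^sup>2 = ip ?u ?u + 2 * ip ?u g + ip g g"
    using ip_add_scale_self[OF u g, of 1] hnorm_power2[OF f] by simp
  also have "\<dots> \<le> (hnorm ip ?u + hnorm ip g)\<^sup>2"
    using ip_abs_le_hnorm[OF u g] hnorm_power2[OF u] hnorm_power2[OF g]
    by (simp add: power2_sum)
  finally show "(hnorm ip f)\<^sup>2 \<le> (hnorm ip ?u + hnorm ip g)\<^sup>2" .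
  show "0 \<le> hnorm ip ?u + hnorm ip g"
    using hnorm_nonneg[OF u] hnorm_nonneg[OF g] by simp
qed

section \<open>Kernel sections as Riesz representers of the components of point evaluation\<close>

definition kernel_section :: "real^'n \<Rightarrow> 'n \<Rightarrow> real^'n \<Rightarrow> real^'n" where
  "kernel_section x i = (\<lambda>u. K u x *v axis i 1)"

lemma kernel_section_mem: "kernel_section x i \<in> H"
  by (simp add: kernel_section_def kernel_mem)

lemma component_eq_ip:
  assumes "f \<in> H"
  shows "f x $ i = ip f (kernel_section x i)"
  unfolding kernel_section_def reproducing[OF assms, symmetric] by (simp add: inner_axis')

lemma ip_kernel_section: "ip (kernel_section x i) (kernel_section y i) = K y x $ i $ i"
  using component_eq_ip[OF kernel_section_mem, of x i y i]
  by (simp add: kernel_section_def matrix_vector_mult_basis column_def)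

lemma norm_eval_le:
  assumes f: "f \<in> H"
  shows "norm (f x) \<le> hnorm ip f * (\<Sum>i\<in>UNIV. hnorm ip (kernel_section x i))"
proof -
  have "norm (f x) \<le> (\<Sum>i\<in>UNIV. \<bar>f x $ i\<bar>)"
    by (rule norm_le_l1_cart)
  also have "\<dots> \<le> (\<Sum>i\<in>UNIV. hnorm ip f * hnorm ip (kernel_section x i))"
    by (intro sum_mono) (simp add: component_eq_ip f ip_abs_le_hnorm kernel_section_mem)
  finally show ?thesis
    by (simp add: sum_distrib_left)
qed

text \<open>A component of \<open>f x - f y\<close> is the inner product of \<open>f\<close> with a
  difference of two kernel sections, whose squared norm is exactly the kernel expression in the
  hypothesis. Bounding the Euclidean norm by the l1 norm costs the dimension factor.\<close>

lemma norm_diff_le: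
  assumes f: "f \<in> H"
    and K: "\<And>i. K x x $ i $ i - 2 * (K x y $ i $ i) + K y y $ i $ i \<le> N\<^sup>2 * (norm (x - y))\<^sup>2"
  shows "norm (f x - f y) \<le> real CARD('n) * \<bar>N\<bar> * hnorm ip f * norm (x - y)"
proof -
  have comp: "\<bar>(f x - f y) $ i\<bar> \<le> hnorm ip f * (\<bar>N\<bar> * norm (x - y))" for i
  proof -
    let ?u = "\<lambda>v. kernel_section x i v - kernel_section y i v"
    note u = diff_mem[OF kernel_section_mem[of x i] kernel_section_mem[of y i]]
    have "ip ?u ?u \<le> N\<^sup>2 * (norm (x - y))\<^sup>2"
      using K[of i] ip_diff_self[OF kernel_section_mem[of x i] kernel_section_mem[of y i]]
        ip_sym[OF kernel_section_mem[of x i] kernel_section_mem[of y i]] by (simp add: ip_kernel_section)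
    then have "hnorm ip ?u \<le> sqrt ((\<bar>N\<bar> * norm (x - y))\<^sup>2)"
      unfolding hnorm_def by (intro real_sqrt_le_mono) (simp add: power_mult_distrib)
    then have "hnorm ip ?u \<le> \<bar>N\<bar> * norm (x - y)"
      by (simp add: abs_mult)
    moreover have "(f x - f y) $ i = ip f ?u"
      by (simp add: component_eq_ip f ip_diff_right kernel_section_mem)
    ultimately show ?thesis
      using order_trans[OF ip_abs_le_hnorm[OF f u] mult_left_mono[OF _ hnorm_nonneg[OF f]]] by simp
  qed
  have "norm (f x - f y) \<le> (\<Sum>i\<in>UNIV. \<bar>(f x - f y) $ i\<bar>)"
    by (rule norm_le_l1_cart)
  also have "\<dots> \<le> (\<Sum>i\<in>(UNIV :: 'n set). hnorm ip f * (\<bar>N\<bar> * norm (x - y)))"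
    by (intro sum_mono comp)
  finally show ?thesis
    by (simp add: mult_ac)
qed

end

section \<open>Trajectories and their Euler schemes\<close>

locale lipschitz_fields =
  fixes A B r T :: real
  assumes A_nonneg: "0 \<le> A" and B_nonneg: "0 \<le> B" and r_nonneg: "0 \<le> r" and T_nonneg: "0 \<le> T"
begin

definition admissible :: "('a::real_inner \<Rightarrow> 'a) \<Rightarrow> bool" where
  "admissible f \<longleftrightarrow> norm (f 0) \<le> A \<and> (\<forall>x y. norm (f x - f y) \<le> B * norm (x - y))"

text \<open>One radius for both Gronwall arguments: adding 1 to the norm (Euler) or to its square
  (ODE) turns the affine growth of the fields into a purely exponential rate at most
  \<open>A + 2 * B\<close>.\<close>

definition radius :: real where
  "radius = (r + 1) * exp ((A + 2 * B) * T)"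

text \<open>Bounds every admissible field on the ball of this radius, hence serves as Lipschitz
  constant in time for trajectories and Euler paths.\<close>

definition speed :: real where
  "speed = A + B * radius"

lemma radius_pos: "0 < radius"
  using r_nonneg by (simp add: radius_def)

lemma speed_nonneg: "0 \<le> speed"
  using A_nonneg B_nonneg radius_pos by (simp add: speed_def)

section \<open>A priori bounds for solutions, Euler paths and their interpolations\<close>

lemma admissible_growth:
  assumes "admissible f"
  shows "norm (f x) \<le> A + B * norm x"
proof -
  have "norm (f 0) \<le> A" "norm (f x - f 0) \<le> B * norm (x - 0)"
    using assms unfolding admissible_def by blast+
  then show ?thesis
    using norm_triangle_sub[of "f x" "f 0"] by simp
qed

lemma admissible_speed:
  assumes "admissible f" "norm x \<le> radius"
  shows "norm (f x) \<le> speed"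
  using admissible_growth[OF assms(1), of x] mult_left_mono[OF assms(2) B_nonneg]
  by (simp add: speed_def)

text \<open>Gronwall: \<open>(\<bar>x\<bar>\<^sup>2 + 1) exp (- c s)\<close> is nonincreasing along a trajectory when \<open>c = A + 2 B\<close>.\<close>

lemma ode_bounded:
  fixes x :: "real \<Rightarrow> 'a::real_inner"
  assumes f: "admissible f" and x0: "norm (x 0) \<le> r"
    and ode: "\<And>s. s \<in> {0..T} \<Longrightarrow> (x has_vector_derivative f (x s)) (at s within {0..T})"
    and s: "s \<in> {0..T}"
  shows "norm (x s) \<le> radius"
proof -
  define c where "c = A + 2 * B"
  define \<phi> where "\<phi> = (\<lambda>s. (x s \<bullet> x s + 1) * exp (- c * s))"
  have "continuous_on {0..T} x"
    by (metis ode continuous_on_eq_continuous_within has_vector_derivative_continuous)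
  then have cont: "continuous_on {0..s} x"
    by (rule continuous_on_subset) (use s in auto)
  have "\<phi> s \<le> \<phi> 0"
  proof (rule DERIV_nonpos_imp_decreasing_open[where f = \<phi>])
    show "0 \<le> s" using s by simp
    show "continuous_on {0..s} \<phi>"
      unfolding \<phi>_def by (intro continuous_intros cont)
    \<comment> \<open>At interior points the derivative within \<open>{0..T}\<close> is an ordinary
      two-sided derivative.\<close>
    fix a assume a: "0 < a" "a < s"
    have "(x has_vector_derivative f (x a)) (at a)"
      using ode[of a] a s by (simp add: at_within_Icc_at)
    then have "(x has_derivative (\<lambda>h. h *\<^sub>R f (x a))) (at a)"
      by (simp add: has_vector_derivative_def)
    then have "(\<phi> has_derivative (\<lambda>h. (2 * (x a \<bullet> f (x a)) - c * (x a \<bullet> x a + 1)) * exp (- c * a) * h)) (at a)"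
      unfolding \<phi>_def
      by (auto intro!: derivative_eq_intros simp: algebra_simps inner_commute)
    then have "DERIV \<phi> a :> (2 * (x a \<bullet> f (x a)) - c * (x a \<bullet> x a + 1)) * exp (- c * a)"
      by (simp add: has_field_derivative_def mult_commute_abs)
    moreover have "2 * (x a \<bullet> f (x a)) - c * (x a \<bullet> x a + 1) \<le> 0"
    proof -
      have "x a \<bullet> f (x a) \<le> norm (x a) * norm (f (x a))"
        by (rule norm_cauchy_schwarz)
      also have "\<dots> \<le> norm (x a) * (A + B * norm (x a))"
        by (intro mult_left_mono admissible_growth f) auto
      finally have "2 * (x a \<bullet> f (x a)) \<le> A * (2 * norm (x a)) + 2 * B * (norm (x a))\<^sup>2"
        by (simp add: power2_eq_square algebra_simps)
      \<comment> \<open>The linear term is absorbed by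
        \<open>2 * norm (x a) \<le> (norm (x a))\<^sup>2 + 1\<close>.\<close>
      also have "\<dots> \<le> A * ((norm (x a))\<^sup>2 + 1) + 2 * B * ((norm (x a))\<^sup>2 + 1)"
        using A_nonneg B_nonneg zero_le_power2[of "norm (x a) - 1"]
        by (intro add_mono mult_left_mono) (auto simp: power2_diff)
      finally show ?thesis
        by (simp add: c_def power2_norm_eq_inner algebra_simps)
    qed
    ultimately show "\<exists>y. DERIV \<phi> a :> y \<and> y \<le> 0"
      by (metis exp_ge_zero mult_nonpos_nonneg)
  qed
  then have "(norm (x s))\<^sup>2 + 1 \<le> ((norm (x 0))\<^sup>2 + 1) * exp (c * s)"
    by (simp add: \<phi>_def power2_norm_eq_inner exp_minus field_simps)
  \<comment> \<open>Both factors are enlarged to perfect squares, so that taking roots gives exactly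
    \<open>radius\<close>.\<close>
  also have "\<dots> \<le> (r + 1)\<^sup>2 * (exp (c * T))\<^sup>2"
  proof (intro mult_mono)
    show "(norm (x 0))\<^sup>2 + 1 \<le> (r + 1)\<^sup>2"
    proof -
      have "(norm (x 0))\<^sup>2 \<le> r\<^sup>2"
        by (intro power_mono x0) simp
      then have "(norm (x 0))\<^sup>2 + 1 \<le> r\<^sup>2 + 2 * r + 1"
        using r_nonneg by linarith
      also have "\<dots> = (r + 1)\<^sup>2"
        by (simp add: power2_sum)
      finally show ?thesis .
    qed
    have "c * s \<le> c * T" "0 \<le> c * T"
      using s A_nonneg B_nonneg T_nonneg by (simp_all add: c_def mult_left_mono)
    then have "exp (c * s) \<le> exp (2 * (c * T))"
      by simp
    then show "exp (c * s) \<le> (exp (c * T))\<^sup>2"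
      by (simp add: exp_double)
  qed auto
  finally have "(norm (x s))\<^sup>2 \<le> radius\<^sup>2"
    by (simp add: radius_def c_def power_mult_distrib)
  then show ?thesis
    by (rule power2_le_imp_le) (use radius_pos in simp)
qed

lemma ode_lipschitz:
  fixes x :: "real \<Rightarrow> 'a::real_inner"
  assumes f: "admissible f" and x0: "norm (x 0) \<le> r"
    and ode: "\<And>s. s \<in> {0..T} \<Longrightarrow> (x has_vector_derivative f (x s)) (at s within {0..T})"
    and s: "s \<in> {0..T}" "s' \<in> {0..T}"
  shows "norm (x s - x s') \<le> speed * \<bar>s - s'\<bar>"
proof -
  have "norm (x s - x s') \<le> speed * norm (s - s')"
  proof (rule differentiable_bound[where S = "{0..T}" and f' = "\<lambda>a h. h *\<^sub>R f (x a)"])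
    show "(x has_derivative (\<lambda>h. h *\<^sub>R f (x a))) (at a within {0..T})" if "a \<in> {0..T}" for a
      using ode[OF that] by (simp add: has_vector_derivative_def)
    show "onorm (\<lambda>h. h *\<^sub>R f (x a)) \<le> speed" if "a \<in> {0..T}" for a
      using admissible_speed[OF f ode_bounded[OF f x0 ode that]] by (intro onorm_le) (simp add: mult.commute mult_left_mono)
  qed (use s in auto)
  then show ?thesis by simp
qed

text \<open>Discrete Gronwall: one step multiplies \<open>norm (z l) + 1\<close> by at most
  \<open>1 + h * c\<close>, which is at most \<open>exp (h * c)\<close>.\<close>

lemma euler_bounded:
  assumes f: "admissible f" and z0: "norm (z 0) \<le> r"
    and euler: "\<And>l. l < k \<Longrightarrow> z (Suc l) = z l + h *\<^sub>R f (z l)"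
    and h: "0 \<le> h" and l: "l \<le> k" "real l * h \<le> T"
  shows "norm (z l) \<le> radius"
proof -
  define c where "c = A + 2 * B"
  have "norm (z l) + 1 \<le> (r + 1) * exp (c * (real l * h))" if "l \<le> k" for l
    using that
  proof (induction l)
    case 0
    then show ?case using z0 by simp
  next
    case (Suc l)
    have "norm (z (Suc l)) + 1 \<le> norm (z l) + h * (A + B * norm (z l)) + 1"
      using euler[of l] Suc.prems h norm_triangle_ineq[of "z l" "h *\<^sub>R f (z l)"]
        mult_left_mono[OF admissible_growth[OF f, of "z l"] h] by simp
    also have "\<dots> \<le> (1 + h * c) * (norm (z l) + 1)"
      using h A_nonneg B_nonneg by (simp add: c_def algebra_simps)
    also have "\<dots> \<le> exp (h * c) * ((r + 1) * exp (c * (real l * h)))"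
      using Suc by (intro mult_mono exp_ge_add_one_self) auto
    also have "\<dots> = (r + 1) * exp (c * (real (Suc l) * h))"
      by (simp add: algebra_simps flip: exp_add)
    finally show ?case .
  qed
  from this[OF l(1)] have "norm (z l) \<le> (r + 1) * exp (c * (real l * h))"
    by simp
  also have "\<dots> \<le> radius"
    using l(2) A_nonneg B_nonneg r_nonneg by (auto simp: radius_def c_def intro!: mult_left_mono)
  finally show ?thesis .
qed

lemma euler_lipschitz:
  assumes f: "admissible f" and z0: "norm (z 0) \<le> r"
    and euler: "\<And>l. l < k \<Longrightarrow> z (Suc l) = z l + h *\<^sub>R f (z l)"
    and h: "0 \<le> h" and kh: "real k * h \<le> T" and l: "i \<le> l" "l \<le> k"
  shows "norm (z l - z i) \<le> speed * (real l * h - real i * h)"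
  using l
proof (induction l rule: dec_induct)
  case base
  then show ?case by simp
next
  case (step l)
  have "real l * h \<le> T"
    using step h kh mult_right_mono[of "real l" "real k" h] by linarith
  then have "norm (f (z l)) \<le> speed"
    using step by (intro admissible_speed f euler_bounded[OF f z0 euler h]) auto
  then have "norm (h *\<^sub>R f (z l)) \<le> speed * h"
    using h by (simp add: mult.commute mult_left_mono)
  moreover have "z (Suc l) - z i = (z l - z i) + h *\<^sub>R f (z l)"
    using euler[of l] step by simp
  ultimately show ?case
    using step norm_triangle_ineq[of "z l - z i" "h *\<^sub>R f (z l)"]
    by (simp add: algebra_simps)
qed

text \<open>Walk from grid point \<open>i\<close> to the last grid point before \<open>s\<close>,
  then along a single segment. The anchor \<open>i\<close> is arbitrary because observation times
  skip grid points.\<close>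

lemma interpolate_lipschitz:
  assumes f: "admissible f" and z0: "norm (z 0) \<le> r"
    and euler: "\<And>l. l < k \<Longrightarrow> z (Suc l) = z l + h *\<^sub>R f (z l)"
    and h: "0 < h" and kh: "real k * h = T" and s: "real i * h \<le> s" "s \<le> T"
  shows "norm (interpolate h z s - z i) \<le> speed * (s - real i * h)"
proof -
  define l where "l = nat \<lfloor>s / h\<rfloor>"
  have s': "real i \<le> s / h" "s / h \<le> real k"
    using s h kh by (simp_all add: field_simps)
  then have l_le: "real l \<le> s / h"
    unfolding l_def by (intro of_nat_floor) linarith
  have l: "i \<le> l" "l \<le> k" "real l * h \<le> s"
  proof -
    show "i \<le> l"
      unfolding l_def by (rule le_nat_floor[OF s'(1)])
    show "l \<le> k"
      using order_trans[OF l_le s'(2)] by simp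
    show "real l * h \<le> s"
      using l_le h by (simp add: pos_le_divide_eq)
  qed
  have interp: "interpolate h z s = z l + ((s - real l * h) / h) *\<^sub>R (z (Suc l) - z l)"
    by (simp add: interpolate_def l_def Let_def)
  have "norm (interpolate h z s - z l) \<le> speed * (s - real l * h)"
  proof (cases "l < k")
    case True
    have "norm (f (z l)) \<le> speed"
      using s l by (intro admissible_speed f euler_bounded[OF f z0 euler]) (use h in auto)
    moreover have "interpolate h z s - z l = (s - real l * h) *\<^sub>R f (z l)"
      using interp euler[OF True] h by simp
    ultimately show ?thesis
      using l mult_right_mono[of "norm (f (z l))" speed "s - real l * h"] by (simp add: mult.commute)
  \<comment> \<open>Here \<open>l = k\<close> and \<open>s = T\<close>. The value
    \<open>z (Suc k)\<close>, on which the scheme imposes nothing, enters the interpolation with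
    coefficient 0.\<close>
  next
    case False
    then have "s = real l * h"
      using l s kh by auto
    then show ?thesis
      using interpolate_grid[OF h] by simp
  qed
  moreover have "norm (z l - z i) \<le> speed * (real l * h - real i * h)"
    using h kh l by (intro euler_lipschitz[OF f z0 euler]) auto
  ultimately show ?thesis
    using norm_triangle_ineq[of "interpolate h z s - z l" "z l - z i"] by (simp add: algebra_simps)
qed

text \<open>The local error per step is at most \<open>B * speed * h\<^sup>2\<close>, and the
  Lipschitz bound amplifies the accumulated error by \<open>1 + h * B\<close> per step.\<close>

lemma euler_error:
  fixes x :: "real \<Rightarrow> 'a::real_inner"
  assumes f: "admissible f" and x0: "norm (x 0) \<le> r"
    and ode: "\<And>s. s \<in> {0..T} \<Longrightarrow> (x has_vector_derivative f (x s)) (at s within {0..T})"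
    and z0: "z 0 = x 0" and euler: "\<And>l. l < k \<Longrightarrow> z (Suc l) = z l + h *\<^sub>R f (z l)"
    and h: "0 \<le> h" and kh: "real k * h \<le> T" and l: "l \<le> k"
  shows "norm (z l - x (real l * h)) \<le> h * speed * exp (B * T)"
proof -
  \<comment> \<open>This is the exact solution of the error recursion. The factor \<open>B\<close>
    of the local error cancels in the geometric sum, so no division by \<open>B\<close>
    occurs.\<close>
  have *: "norm (z l - x (real l * h)) \<le> h * speed * ((1 + h * B) ^ l - 1)" if "l \<le> k" for l
    using that
  proof (induction l)
    case 0
    then show ?case using z0 by simp
  next
    case (Suc l)
    define a b where "a = real l * h" and "b = real (Suc l) * h"
    have ab: "0 \<le> a" "a \<le> b" "b - a = h" "b \<le> T"
      using h kh Suc.prems mult_right_mono[of "real (Suc l)" "real k" h]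
      by (auto simp: a_def b_def algebra_simps)
    \<comment> \<open>Local error: over one step the velocity differs from its initial value by at
      most \<open>B\<close> times the distance travelled.\<close>
    have "norm (x b - x a - (b - a) *\<^sub>R f (x a)) \<le> norm (b - a) * (B * (speed * h))"
    proof (rule vector_differentiable_bound_linearization[where S = "{a..b}"])
      show "(x has_vector_derivative f (x s)) (at s within {a..b})" if "s \<in> {a..b}" for s
        using ode[of s] that ab by (auto intro: has_vector_derivative_within_subset)
      show "norm (f (x s) - f (x a)) \<le> B * (speed * h)" if "s \<in> {a..b}" for s
      proof -
        have "norm (x s - x a) \<le> speed * \<bar>s - a\<bar>"
          using that ab by (intro ode_lipschitz[OF f x0 ode]) auto
        also have "\<dots> \<le> speed * h"
          using that ab speed_nonneg by (intro mult_left_mono) auto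
        finally have "B * norm (x s - x a) \<le> B * (speed * h)"
          using B_nonneg by (rule mult_left_mono)
        then show ?thesis
          using f unfolding admissible_def by (meson order_trans)
      qed
    qed (use ab in \<open>auto simp: closed_segment_eq_real_ivl\<close>)
    then have step_error: "norm (x a + h *\<^sub>R f (x a) - x b) \<le> h * (B * (speed * h))"
      using ab h by (simp add: norm_minus_commute algebra_simps)
    have "norm (h *\<^sub>R (f (z l) - f (x a))) \<le> h * (B * norm (z l - x a))"
      using f h by (simp add: admissible_def mult_left_mono)
    \<comment> \<open>Three parts: the previous error, its propagation through the field, and the
      local error.\<close>
    moreover have split: "z (Suc l) - x b
        = (z l - x a) + h *\<^sub>R (f (z l) - f (x a)) + (x a + h *\<^sub>R f (x a) - x b)"
      using euler[of l] Suc.prems by (simp add: scaleR_diff_right)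
    ultimately have "norm (z (Suc l) - x b)
        \<le> norm (z l - x a) + h * (B * norm (z l - x a)) + h * (B * (speed * h))"
      unfolding split using step_error norm_triangle_ineq[of "z l - x a + h *\<^sub>R (f (z l) - f (x a))" "x a + h *\<^sub>R f (x a) - x b"]
        norm_triangle_ineq[of "z l - x a" "h *\<^sub>R (f (z l) - f (x a))"] by linarith
    also have "\<dots> = (1 + h * B) * norm (z l - x a) + h * (B * (speed * h))"
      by (simp add: algebra_simps)
    also have "\<dots> \<le> (1 + h * B) * (h * speed * ((1 + h * B) ^ l - 1)) + h * (B * (speed * h))"
      using Suc h B_nonneg by (intro add_right_mono mult_left_mono) (auto simp: a_def)
    also have "\<dots> = h * speed * ((1 + h * B) ^ Suc l - 1)"
      by (simp add: algebra_simps)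
    finally show ?case
      by (simp add: b_def)
  qed
  have "(1 + h * B) ^ l \<le> exp (h * B) ^ l"
    using h B_nonneg by (intro power_mono exp_ge_add_one_self) simp
  also have "\<dots> = exp (B * (real l * h))"
    by (simp add: mult_ac flip: exp_of_nat_mult)
  also have "\<dots> \<le> exp (B * T)"
    using mult_right_mono[of "real l" "real k" h] l h kh B_nonneg by (auto intro: mult_left_mono)
  finally have "(1 + h * B) ^ l - 1 \<le> exp (B * T)"
    by simp
  then have "h * speed * ((1 + h * B) ^ l - 1) \<le> h * speed * exp (B * T)"
    using h speed_nonneg by (intro mult_left_mono) auto
  then show ?thesis
    using *[OF l] by simp
qed

end

section \<open>Weighted sums over the observation times\<close>

lemma consecutive_interval_cover:
  fixes t :: "nat \<Rightarrow> real"
  assumes "1 \<le> m" "t 1 \<le> s" "s \<le> t (Suc m)"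
  shows "\<exists>j\<in>{1..m}. t j \<le> s \<and> s \<le> t (Suc j)"
  using assms
proof (induction m rule: dec_induct)
  case base
  then show ?case by auto
next
  case (step m)
  then show ?case
    by (cases "s \<le> t (Suc m)") (auto simp: not_le intro: less_imp_le dest: bspec)
qed

text \<open>Domination by a step function. The closed intervals may overlap at endpoints, which only
  enlarges the upper bound since each \<open>a j\<close> bounds a square and is nonnegative.\<close>

lemma L2_norm_sq_le_sum:
  fixes g :: "real \<Rightarrow> real^'n" and t :: "nat \<Rightarrow> real"
  assumes m: "1 \<le> m" and t: "t 1 = 0" "t (Suc m) = T" "\<And>j. j \<in> {1..m} \<Longrightarrow> t j \<le> t (Suc j)"
    and g: "\<And>j s. j \<in> {1..m} \<Longrightarrow> t j \<le> s \<Longrightarrow> s \<le> t (Suc j) \<Longrightarrow> (norm (g s))\<^sup>2 \<le> a j"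
  shows "L2_norm_sq T g \<le> (\<Sum>j=1..m. (t (Suc j) - t j) * a j)"
proof -
  have a: "0 \<le> a j" if "j \<in> {1..m}" for j
    using g[OF that order_refl t(3)[OF that]] zero_le_power2 order_trans by blast
  show ?thesis
  proof (cases "integrable lborel (\<lambda>s. indicator {0..T} s *\<^sub>R (norm (g s))\<^sup>2)")
    case True
    have "L2_norm_sq T g \<le> (LINT s|lborel. (\<Sum>j=1..m. indicator {t j..t (Suc j)} s * a j))"
      unfolding L2_norm_sq_def set_lebesgue_integral_def
    proof (rule integral_mono[OF True])
      show "integrable lborel (\<lambda>s. \<Sum>j=1..m. indicator {t j..t (Suc j)} s * a j)"
        by (intro Bochner_Integration.integrable_sum integrable_mult_left)
          (simp add: integrable_indicator_iff emeasure_lborel_Icc_eq)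
      fix s
      have nonneg: "0 \<le> indicator {t j..t (Suc j)} s * a j" if "j \<in> {1..m}" for j
        using a[OF that] by (simp add: indicator_def)
      show "indicator {0..T} s *\<^sub>R (norm (g s))\<^sup>2 \<le> (\<Sum>j=1..m. indicator {t j..t (Suc j)} s * a j)"
      proof (cases "s \<in> {0..T}")
        case True
        then obtain j where j: "j \<in> {1..m}" "t j \<le> s" "s \<le> t (Suc j)"
          using consecutive_interval_cover[OF m, of t s] t by auto
        have "(norm (g s))\<^sup>2 \<le> indicator {t j..t (Suc j)} s * a j"
          using g[OF j] j by simp
        also have "\<dots> \<le> (\<Sum>j=1..m. indicator {t j..t (Suc j)} s * a j)"
          by (rule member_le_sum) (use j nonneg in auto)
        finally show ?thesis using True by simp
      next
        case False
        then show ?thesis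
          using sum_nonneg[of "{1..m}", OF nonneg] by simp
      qed
    qed
    also have "\<dots> = (\<Sum>j=1..m. (t (Suc j) - t j) * a j)"
      using t(3) by (subst Bochner_Integration.integral_sum)
        (auto simp: integrable_indicator_iff emeasure_lborel_Icc_eq intro!: integrable_mult_left sum.cong)
    finally show ?thesis .
  next
    \<comment> \<open>The Bochner integral of a non-integrable function is 0 by convention, so the
      bound holds without any measurability of \<open>g\<close>.\<close>
    case False
    then have "L2_norm_sq T g = 0"
      by (simp add: L2_norm_sq_def set_lebesgue_integral_def not_integrable_integral_eq)
    then show ?thesis
      using t(3) a by (auto intro!: sum_nonneg)
  qed
qed

text \<open>Expanding the squares cancels the terms quadratic in the noise \<open>e\<close>, which
  survives only linearly, paired with \<open>p - q\<close>.\<close>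

lemma weighted_least_squares_inequality:
  fixes x e p q :: "'i \<Rightarrow> 'a::real_inner" and w :: "'i \<Rightarrow> real"
  assumes "(\<Sum>j\<in>J. w j * (norm (x j + e j - p j))\<^sup>2) \<le> (\<Sum>j\<in>J. w j * (norm (x j + e j - q j))\<^sup>2)"
  shows "(\<Sum>j\<in>J. w j * (norm (p j - x j))\<^sup>2)
    \<le> (\<Sum>j\<in>J. w j * (norm (q j - x j))\<^sup>2) + 2 * (\<Sum>j\<in>J. (w j *\<^sub>R e j) \<bullet> (p j - q j))"
proof -
  have "w j * (norm (x j + e j - p j))\<^sup>2 - w j * (norm (x j + e j - q j))\<^sup>2
    = w j * (norm (p j - x j))\<^sup>2 - w j * (norm (q j - x j))\<^sup>2 - 2 * ((w j *\<^sub>R e j) \<bullet> (p j - q j))" for j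
    by (simp add: power2_norm_eq_inner inner_commute algebra_simps)
  then have "(\<Sum>j\<in>J. w j * (norm (x j + e j - p j))\<^sup>2) - (\<Sum>j\<in>J. w j * (norm (x j + e j - q j))\<^sup>2)
    = (\<Sum>j\<in>J. w j * (norm (p j - x j))\<^sup>2) - (\<Sum>j\<in>J. w j * (norm (q j - x j))\<^sup>2)
      - 2 * (\<Sum>j\<in>J. (w j *\<^sub>R e j) \<bullet> (p j - q j))"
    by (simp add: sum_distrib_left flip: sum_subtractf)
  with assms show ?thesis by simp
qed

section \<open>Abel summation against Lipschitz paths\<close>

lemma sum_inner_by_parts:
  fixes v g :: "nat \<Rightarrow> 'a::real_inner"
  shows "(\<Sum>j=1..Suc n. v j \<bullet> g j)
    = (\<Sum>i=1..Suc n. v i) \<bullet> g (Suc n) - (\<Sum>j=1..n. (\<Sum>i=1..j. v i) \<bullet> (g (Suc j) - g j))"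
  by (induction n) (simp_all add: inner_add_left inner_diff_right)

text \<open>\<open>L\<close> times a gap bounds an increment of the path, and \<open>D\<close>
  bounds its final value in the boundary term. Including the gap at \<open>j = m\<close> makes the
  total weight telescope.\<close>

definition abel_weight :: "real \<Rightarrow> real \<Rightarrow> (nat \<Rightarrow> real) \<Rightarrow> nat \<Rightarrow> nat \<Rightarrow> real" where
  "abel_weight D L t m j = L * (t (Suc j) - t j) + (if j = m then D else 0)"

lemma sum_abel_weight:
  assumes "1 \<le> m"
  shows "(\<Sum>j=1..m. abel_weight D L t m j) = L * (t (Suc m) - t 1) + D"
  using assms by (simp add: abel_weight_def sum.distrib sum_Suc_diff flip: sum_distrib_left)

text \<open>The right-hand side does not depend on \<open>g\<close>, so it controls the noise
  uniformly, even for a path \<open>g\<close> that itself depends on the noise.\<close>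

lemma sum_inner_le_partial_sums:
  fixes v g :: "nat \<Rightarrow> 'a::real_inner"
  assumes m: "1 \<le> m" and D: "norm (g m) \<le> D" and t: "0 \<le> L * (t (Suc m) - t m)"
    and g: "\<And>j. 1 \<le> j \<Longrightarrow> j < m \<Longrightarrow> norm (g (Suc j) - g j) \<le> L * (t (Suc j) - t j)"
  shows "(\<Sum>j=1..m. v j \<bullet> g j) \<le> (\<Sum>j=1..m. abel_weight D L t m j * norm (\<Sum>i=1..j. v i))"
proof -
  obtain n where n: "m = Suc n"
    using m by (cases m) auto
  have "(\<Sum>i=1..m. v i) \<bullet> g m \<le> abel_weight D L t m m * norm (\<Sum>i=1..m. v i)"
  proof -
    have "(\<Sum>i=1..m. v i) \<bullet> g m \<le> norm (\<Sum>i=1..m. v i) * D"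
      by (rule order_trans[OF norm_cauchy_schwarz mult_left_mono[OF D]]) simp
    also have "\<dots> \<le> norm (\<Sum>i=1..m. v i) * abel_weight D L t m m"
      using t by (intro mult_left_mono) (auto simp: abel_weight_def)
    finally show ?thesis by (simp add: mult.commute)
  qed
  moreover have "- (\<Sum>j=1..n. (\<Sum>i=1..j. v i) \<bullet> (g (Suc j) - g j))
      \<le> (\<Sum>j=1..n. abel_weight D L t m j * norm (\<Sum>i=1..j. v i))"
    unfolding sum_negf[symmetric]
  proof (rule sum_mono)
    fix j assume j: "j \<in> {1..n}"
    have "- ((\<Sum>i=1..j. v i) \<bullet> (g (Suc j) - g j)) \<le> norm (\<Sum>i=1..j. v i) * norm (g (Suc j) - g j)"
      using Cauchy_Schwarz_ineq2[of "\<Sum>i=1..j. v i" "g (Suc j) - g j"] by linarith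
    also have "\<dots> \<le> norm (\<Sum>i=1..j. v i) * abel_weight D L t m j"
      using g[of j] j n by (intro mult_left_mono) (auto simp: abel_weight_def)
    finally show "- ((\<Sum>i=1..j. v i) \<bullet> (g (Suc j) - g j)) \<le> abel_weight D L t m j * norm (\<Sum>i=1..j. v i)"
      by (simp add: mult.commute)
  qed
  ultimately show ?thesis
    unfolding n sum_inner_by_parts by simp
qed

section \<open>Exponential moments\<close>

context prob_space
begin

lemma hoeffding_mgf:
  fixes X :: "'b \<Rightarrow> 'a \<Rightarrow> real"
  assumes I: "finite I" and indep: "indep_vars (\<lambda>_. borel) X I"
    and bound: "\<And>i. i \<in> I \<Longrightarrow> AE x in M. \<bar>X i x\<bar> \<le> b i"
    and mean: "\<And>i. i \<in> I \<Longrightarrow> expectation (X i) = 0" and s: "0 < s"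
  shows "(\<integral>\<^sup>+x. ennreal (exp (s * (\<Sum>i\<in>I. X i x))) \<partial>M) \<le> ennreal (exp (s\<^sup>2 * (\<Sum>i\<in>I. (b i)\<^sup>2) / 2))"
proof -
  have X [measurable]: "random_variable borel (X i)" if "i \<in> I" for i
    using indep that by (simp add: indep_vars_def)
  have "(\<integral>\<^sup>+x. ennreal (exp (s * (\<Sum>i\<in>I. X i x))) \<partial>M) = (\<integral>\<^sup>+x. (\<Prod>i\<in>I. ennreal (exp (s * X i x))) \<partial>M)"
    by (intro nn_integral_cong) (simp add: sum_distrib_left exp_sum I prod_ennreal)
  also have "\<dots> = (\<Prod>i\<in>I. \<integral>\<^sup>+x. ennreal (exp (s * X i x)) \<partial>M)"
    by (intro indep_vars_nn_integral I indep_vars_compose2[OF indep]) auto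
  also have "\<dots> \<le> (\<Prod>i\<in>I. ennreal (exp (s\<^sup>2 * (b i)\<^sup>2 / 2)))"
  proof (rule prod_mono_ennreal)
    fix i assume i: "i \<in> I"
    interpret interval_bounded_random_variable M "X i" "- b i" "b i"
      by unfold_locales (use X[OF i] bound[OF i] in auto)
    show "(\<integral>\<^sup>+x. ennreal (exp (s * X i x)) \<partial>M) \<le> ennreal (exp (s\<^sup>2 * (b i)\<^sup>2 / 2))"
      \<comment> \<open>The range has width \<open>2 * b i\<close>, and
        \<open>(2 * b i)\<^sup>2 / 8 = (b i)\<^sup>2 / 2\<close>.\<close>
      using Hoeffdings_lemma_nn_integral_0[OF s mean[OF i]] by (simp add: power2_eq_square mult_ac)
  qed
  also have "\<dots> = ennreal (exp (s\<^sup>2 * (\<Sum>i\<in>I. (b i)\<^sup>2) / 2))"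
    by (simp add: prod_ennreal I sum_distrib_left sum_divide_distrib flip: exp_sum)
  finally show ?thesis .
qed

text \<open>The factor 2 comes from bounding the exponential of an absolute value by the sum of the
  exponentials of both signs.\<close>

lemma hoeffding_mgf_abs:
  fixes X :: "'b \<Rightarrow> 'a \<Rightarrow> real"
  assumes I: "finite I" and indep: "indep_vars (\<lambda>_. borel) X I"
    and bound: "\<And>i. i \<in> I \<Longrightarrow> AE x in M. \<bar>X i x\<bar> \<le> b i"
    and mean: "\<And>i. i \<in> I \<Longrightarrow> expectation (X i) = 0" and s: "0 < s"
  shows "(\<integral>\<^sup>+x. ennreal (exp (s * \<bar>\<Sum>i\<in>I. X i x\<bar>)) \<partial>M) \<le> ennreal (2 * exp (s\<^sup>2 * (\<Sum>i\<in>I. (b i)\<^sup>2) / 2))"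
proof -
  have X [measurable]: "random_variable borel (X i)" if "i \<in> I" for i
    using indep that by (simp add: indep_vars_def)
  have "(\<integral>\<^sup>+x. ennreal (exp (s * \<bar>\<Sum>i\<in>I. X i x\<bar>)) \<partial>M)
      \<le> (\<integral>\<^sup>+x. ennreal (exp (s * (\<Sum>i\<in>I. X i x))) + ennreal (exp (s * (\<Sum>i\<in>I. - X i x))) \<partial>M)"
    by (intro nn_integral_mono) (auto simp: abs_if sum_negf simp flip: ennreal_plus intro!: ennreal_leI)
  also have "\<dots> = (\<integral>\<^sup>+x. ennreal (exp (s * (\<Sum>i\<in>I. X i x))) \<partial>M)
      + (\<integral>\<^sup>+x. ennreal (exp (s * (\<Sum>i\<in>I. - X i x))) \<partial>M)"
    by (rule nn_integral_add) measurable
  also have "\<dots> \<le> ennreal (exp (s\<^sup>2 * (\<Sum>i\<in>I. (b i)\<^sup>2) / 2)) + ennreal (exp (s\<^sup>2 * (\<Sum>i\<in>I. (b i)\<^sup>2) / 2))"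
  proof (intro add_mono hoeffding_mgf assms)
    show "indep_vars (\<lambda>_. borel) (\<lambda>i x. - X i x) I"
      by (rule indep_vars_compose2[OF indep]) simp
  qed (use bound mean in auto)
  also have "\<dots> = ennreal (2 * exp (s\<^sup>2 * (\<Sum>i\<in>I. (b i)\<^sup>2) / 2))"
    by (simp flip: ennreal_plus)
  finally show ?thesis .
qed

text \<open>No independence between the \<open>V i\<close>: convexity of the exponential reduces the exponential
  moment of the sum to those of its terms.\<close>

lemma subgaussian_weighted_sum_tail:
  fixes V :: "'b \<Rightarrow> 'a \<Rightarrow> real"
  assumes I: "finite I" and V: "\<And>i. i \<in> I \<Longrightarrow> random_variable borel (V i)"
    and c: "\<And>i. i \<in> I \<Longrightarrow> 0 \<le> c i" "(\<Sum>i\<in>I. c i) = Q" and Q: "0 < Q" and v: "0 < v" and u: "0 < u"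
    and mgf: "\<And>i s. i \<in> I \<Longrightarrow> 0 < s \<Longrightarrow>
      (\<integral>\<^sup>+x. ennreal (exp (s * V i x)) \<partial>M) \<le> ennreal (2 * exp (s\<^sup>2 * v / 2))"
  shows "emeasure M {x \<in> space M. u \<le> (\<Sum>i\<in>I. c i * V i x)} \<le> ennreal (2 * exp (- (u\<^sup>2 / (2 * Q\<^sup>2 * v))))"
proof -
  \<comment> \<open>The minimiser of the Chernoff exponent
    \<open>- s * u + (s * Q)\<^sup>2 * v / 2\<close>.\<close>
  define s where "s = u / (Q\<^sup>2 * v)"
  have s: "0 < s" using Q v u by (simp add: s_def)
  note V [measurable]
  have p: "(\<Sum>i\<in>I. c i / Q) = 1" "I \<noteq> {}"
    using c Q by (auto simp flip: sum_divide_distrib)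
  \<comment> \<open>The weights \<open>c i / Q\<close> sum to 1; the compensating factor
    \<open>Q\<close> moves into the exponent.\<close>
  have jensen: "exp (s * (\<Sum>i\<in>I. c i * V i x)) \<le> (\<Sum>i\<in>I. c i / Q * exp (s * Q * V i x))" for x
  proof -
    have "exp (\<Sum>i\<in>I. (c i / Q) *\<^sub>R (s * Q * V i x)) \<le> (\<Sum>i\<in>I. c i / Q * exp (s * Q * V i x))"
      using I p c Q convex_on_exp[of 1] by (intro convex_on_sum[where C = UNIV]) auto
    moreover have "(\<Sum>i\<in>I. (c i / Q) *\<^sub>R (s * Q * V i x)) = s * (\<Sum>i\<in>I. c i * V i x)"
      using Q by (simp add: sum_distrib_left mult_ac)
    ultimately show ?thesis by simp
  qed
  have "emeasure M {x \<in> space M. u \<le> (\<Sum>i\<in>I. c i * V i x)}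
      \<le> ennreal (exp (- s * u)) * (\<integral>\<^sup>+x\<in>space M. ennreal (exp (s * (\<Sum>i\<in>I. c i * V i x))) \<partial>M)"
    by (rule Chernoff_ineq_nn_integral_ge[OF s]) measurable
  also have "(\<integral>\<^sup>+x\<in>space M. ennreal (exp (s * (\<Sum>i\<in>I. c i * V i x))) \<partial>M)
      \<le> (\<integral>\<^sup>+x. (\<Sum>i\<in>I. ennreal (c i / Q) * ennreal (exp (s * Q * V i x))) \<partial>M)"
  proof (rule nn_integral_mono)
    fix x assume "x \<in> space M"
    have "ennreal (exp (s * (\<Sum>i\<in>I. c i * V i x))) \<le> ennreal (\<Sum>i\<in>I. c i / Q * exp (s * Q * V i x))"
      by (rule ennreal_leI[OF jensen])
    also have "\<dots> = (\<Sum>i\<in>I. ennreal (c i / Q) * ennreal (exp (s * Q * V i x)))"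
      using c Q by (simp add: sum_nonneg flip: ennreal_mult)
    finally show "ennreal (exp (s * (\<Sum>i\<in>I. c i * V i x))) * indicator (space M) x
        \<le> (\<Sum>i\<in>I. ennreal (c i / Q) * ennreal (exp (s * Q * V i x)))"
      using \<open>x \<in> space M\<close> by simp
  qed
  also have "\<dots> = (\<Sum>i\<in>I. ennreal (c i / Q) * (\<integral>\<^sup>+x. ennreal (exp (s * Q * V i x)) \<partial>M))"
    by (subst nn_integral_sum) (auto simp: nn_integral_cmult)
  also have "\<dots> \<le> (\<Sum>i\<in>I. ennreal (c i / Q) * ennreal (2 * exp ((s * Q)\<^sup>2 * v / 2)))"
    using s Q by (intro sum_mono mult_left_mono mgf) auto
  \<comment> \<open>An average of equal bounds: unlike in a union bound, the number of terms does
    not enter.\<close>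
  also have "\<dots> = ennreal (2 * exp ((s * Q)\<^sup>2 * v / 2))"
    using c Q p by (simp add: sum_ennreal flip: sum_distrib_right)
  finally have "emeasure M {x \<in> space M. u \<le> (\<Sum>i\<in>I. c i * V i x)}
      \<le> ennreal (exp (- s * u)) * ennreal (2 * exp ((s * Q)\<^sup>2 * v / 2))"
    by (simp add: mult_left_mono)
  also have "\<dots> = ennreal (2 * exp (- s * u + (s * Q)\<^sup>2 * v / 2))"
    by (subst exp_add) (simp add: mult.left_commute flip: ennreal_mult)
  also have "- s * u + (s * Q)\<^sup>2 * v / 2 = - (u\<^sup>2 / (2 * Q\<^sup>2 * v))"
    using Q v by (simp add: s_def field_simps power2_eq_square)
  finally show ?thesis .
qed

end

section \<open>The estimator\<close>

lemma observation_grid_facts: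
  assumes grid: "observation_grid T h k m \<kappa> t" and T: "0 < T"
  shows "0 < h" and "1 \<le> m" and "t 1 = 0" and "t (Suc m) = T"
    and "\<And>j. j \<in> {1..m} \<Longrightarrow> t j = real (\<kappa> j) * h"
    and "\<And>j. j \<in> {1..m} \<Longrightarrow> \<kappa> j \<le> k"
    and "\<And>j. j \<in> {1..m} \<Longrightarrow> t j \<le> t (Suc j)"
    and "\<And>j. j \<in> {1..m} \<Longrightarrow> t j \<in> {0..T}"
    and "\<And>j. j \<in> {1..m} \<Longrightarrow> t (Suc j) \<in> {0..T}"
proof -
  have kh: "real k * h = T" and m: "1 \<le> m" and \<kappa>1: "\<kappa> 1 = 0" and mono: "strict_mono_on {1..m} \<kappa>"
    and \<kappa>m: "\<kappa> m \<le> k" and tj: "\<And>j. j \<in> {1..m} \<Longrightarrow> t j = real (\<kappa> j) * h" and tm: "t (Suc m) = T"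
    using grid by (auto simp: observation_grid_def)
  show h: "0 < h"
    using kh T by (metis of_nat_0_le_iff zero_less_mult_pos mult_eq_0_iff order_le_less)
  show "1 \<le> m" "t (Suc m) = T" and t1: "t 1 = 0"
    using m tm tj[of 1] \<kappa>1 by auto
  show tj': "t j = real (\<kappa> j) * h" if "j \<in> {1..m}" for j
    by (rule tj[OF that])
  show \<kappa>k: "\<kappa> j \<le> k" if "j \<in> {1..m}" for j
    using strict_mono_on_leD[OF mono that, of m] that \<kappa>m by auto
  have Icc: "t j \<in> {0..T}" if "j \<in> {1..m}" for j
    using tj[OF that] h \<kappa>k[OF that] by (simp flip: kh)
  then show "t j \<in> {0..T}" if "j \<in> {1..m}" for j
    using that .
  \<comment> \<open>Gaps between observations are positive, but the last one, up to
    \<open>T\<close>, vanishes when \<open>\<kappa> m = k\<close>.\<close>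
  show "t j \<le> t (Suc j)" if "j \<in> {1..m}" for j
  proof (cases "j = m")
    case True
    then show ?thesis using Icc[OF that] tm by simp
  next
    case False
    then have "\<kappa> j < \<kappa> (Suc j)"
      using that by (intro strict_mono_onD[OF mono]) auto
    then show ?thesis
      using tj[of j] tj[of "Suc j"] that False h by simp
  qed
  show "t (Suc j) \<in> {0..T}" if "j \<in> {1..m}" for j
    using Icc[of "Suc j"] that tm T by (cases "j = m") auto
qed

section \<open>The deterministic error bound\<close>

context lipschitz_fields
begin

text \<open>The three summands are the squared Euler error of the comparison path, the cost of
  passing from observation times to all times, and the noise term after summation by parts.\<close>

lemma estimation_error_le:
  fixes x :: "real \<Rightarrow> real^'n"
  assumes T: "0 < T" and grid: "observation_grid T h k m \<kappa> t"
    and fs: "admissible fs" and x0: "norm (x 0) \<le> r"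
    and ode: "\<And>s. s \<in> {0..T} \<Longrightarrow> (x has_vector_derivative fs (x s)) (at s within {0..T})"
    and f: "admissible f" and z0: "norm (z 0) \<le> r"
    and euler: "\<And>l. l < k \<Longrightarrow> z (Suc l) = z l + h *\<^sub>R f (z l)"
    and optimal: "\<And>q. q 0 = x 0 \<Longrightarrow> (\<And>l. q (Suc l) = q l + h *\<^sub>R fs (q l)) \<Longrightarrow>
      loss m \<kappa> t (\<lambda>j. x (t j) + e j) z \<le> loss m \<kappa> t (\<lambda>j. x (t j) + e j) q"
  shows "L2_norm_sq T (\<lambda>s. interpolate h z s - x s)
    \<le> T * (h * speed * exp (B * T))\<^sup>2
      + (8 * speed * radius + 4 * speed\<^sup>2 * T) * (\<Sum>j=1..m. (t (Suc j) - t j)\<^sup>2)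
      + 2 * (\<Sum>j=1..m. abel_weight (2 * radius) (2 * speed) t m j
          * norm (\<Sum>i=1..j. (t (Suc i) - t i) *\<^sub>R e i))"
proof -
  note g = observation_grid_facts[OF grid T]
  note kh = grid[unfolded observation_grid_def, THEN conjunct1]
  define w where "w = (\<lambda>j. t (Suc j) - t j)"
  define C where "C = 8 * speed * radius + 4 * speed\<^sup>2 * T"
  \<comment> \<open>The Euler path of the true field from the true initial value; the true
    trajectory itself need not satisfy the discrete constraint.\<close>
  define q where "q = rec_nat (x 0) (\<lambda>l u. u + h *\<^sub>R fs u)"
  have q: "q 0 = x 0" "\<And>l. q (Suc l) = q l + h *\<^sub>R fs (q l)"
    by (simp_all add: q_def)
  have w: "0 \<le> w j" "w j \<le> T" if "j \<in> {1..m}" for j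
    using g(7,8,9)[OF that] by (auto simp: w_def)
  have sum_w: "(\<Sum>j=1..m. w j) = T"
    using g(2-4) by (simp add: w_def sum_Suc_diff)
  have x_bd: "norm (x s) \<le> radius" if "s \<in> {0..T}" for s
    by (rule ode_bounded[OF fs x0 ode that])
  have grid_le: "real (\<kappa> j) * h \<le> T" if "j \<in> {1..m}" for j
    using g(5,8)[OF that] by simp
  have z_bd: "norm (z (\<kappa> j)) \<le> radius" if "j \<in> {1..m}" for j
    using euler_bounded[OF f z0 euler _ g(6)[OF that] grid_le[OF that]] g(1) by simp
  have q_bd: "norm (q (\<kappa> j)) \<le> radius" if "j \<in> {1..m}" for j
    using euler_bounded[OF fs, of q, OF _ q(2) _ g(6)[OF that] grid_le[OF that]] g(1) q(1) x0 by simp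

  have "L2_norm_sq T (\<lambda>s. interpolate h z s - x s)
      \<le> (\<Sum>j=1..m. (t (Suc j) - t j) * ((norm (z (\<kappa> j) - x (t j)))\<^sup>2 + C * w j))"
  proof (rule L2_norm_sq_le_sum[OF g(2-4,7)])
    fix j s assume j: "j \<in> {1..m}" and s: "t j \<le> s" "s \<le> t (Suc j)"
    define N where "N = norm (z (\<kappa> j) - x (t j))"
    have N: "0 \<le> N" "N \<le> 2 * radius"
      using norm_triangle_ineq4[of "z (\<kappa> j)" "x (t j)"] z_bd[OF j] x_bd[OF g(8)[OF j]]
      by (simp_all add: N_def)
    have s': "s \<in> {0..T}"
      using s g(8,9)[OF j] by auto
    have "norm (interpolate h z s - z (\<kappa> j)) \<le> speed * (s - t j)"
      using interpolate_lipschitz[OF f z0 euler g(1) kh, of "\<kappa> j" s] s s' g(5)[OF j] by simp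
    moreover have "norm (x (t j) - x s) \<le> speed * (s - t j)"
      using ode_lipschitz[OF fs x0 ode g(8)[OF j] s'] s by simp
    moreover have "speed * (s - t j) \<le> speed * w j"
      using s speed_nonneg by (intro mult_left_mono) (auto simp: w_def)
    moreover have "norm (interpolate h z s - x s)
        \<le> norm (interpolate h z s - z (\<kappa> j)) + N + norm (x (t j) - x s)"
    proof -
      have "interpolate h z s - x s
          = (interpolate h z s - z (\<kappa> j)) + (z (\<kappa> j) - x (t j)) + (x (t j) - x s)"
        by simp
      then show ?thesis
        unfolding N_def by (metis norm_triangle_ineq norm_triangle_mono order_refl)
    qed
    ultimately have "norm (interpolate h z s - x s) \<le> N + 2 * (speed * w j)"
      by linarith
    then have "(norm (interpolate h z s - x s))\<^sup>2 \<le> (N + 2 * (speed * w j))\<^sup>2"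
      by (intro power_mono) auto
    also have "\<dots> = N\<^sup>2 + (4 * speed * w j) * N + (4 * speed\<^sup>2 * w j) * w j"
      by (simp add: power2_eq_square algebra_simps)
    \<comment> \<open>One factor \<open>w j\<close> is kept in each mixed term; multiplied by the
      interval length it yields the sum of squared gaps.\<close>
    also have "\<dots> \<le> N\<^sup>2 + (4 * speed * w j) * (2 * radius) + (4 * speed\<^sup>2 * w j) * T"
      using N w[OF j] speed_nonneg by (intro add_mono mult_left_mono) auto
    also have "\<dots> = N\<^sup>2 + C * w j"
      by (simp add: C_def algebra_simps)
    finally show "(norm (interpolate h z s - x s))\<^sup>2 \<le> (norm (z (\<kappa> j) - x (t j)))\<^sup>2 + C * w j"
      by (simp add: N_def)
  qed
  also have "\<dots> = (\<Sum>j=1..m. w j * (norm (z (\<kappa> j) - x (t j)))\<^sup>2) + C * (\<Sum>j=1..m. (w j)\<^sup>2)"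
    unfolding sum_distrib_left sum.distrib[symmetric]
    by (intro sum.cong) (auto simp: w_def power2_eq_square algebra_simps)
  also have "(\<Sum>j=1..m. w j * (norm (z (\<kappa> j) - x (t j)))\<^sup>2)
      \<le> (\<Sum>j=1..m. w j * (norm (q (\<kappa> j) - x (t j)))\<^sup>2)
        + 2 * (\<Sum>j=1..m. (w j *\<^sub>R e j) \<bullet> (z (\<kappa> j) - q (\<kappa> j)))"
    using optimal[OF q] unfolding loss_def w_def
    by (rule weighted_least_squares_inequality)
  also have "(\<Sum>j=1..m. w j * (norm (q (\<kappa> j) - x (t j)))\<^sup>2) \<le> (\<Sum>j=1..m. w j * (h * speed * exp (B * T))\<^sup>2)"
  proof (intro sum_mono mult_left_mono power_mono)
    fix j assume j: "j \<in> {1..m}"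
    show "norm (q (\<kappa> j) - x (t j)) \<le> h * speed * exp (B * T)"
      using euler_error[OF fs x0 ode q(1) q(2) _ _ g(6)[OF j]] g(1) kh g(5)[OF j] by simp
  qed (use w in auto)
  also have "\<dots> = T * (h * speed * exp (B * T))\<^sup>2"
    by (simp only: sum_w flip: sum_distrib_right)
  \<comment> \<open>Both paths stay in the ball and move at most at \<open>speed\<close>, so their
    difference has the doubled constants.\<close>
  also have "(\<Sum>j=1..m. (w j *\<^sub>R e j) \<bullet> (z (\<kappa> j) - q (\<kappa> j)))
      \<le> (\<Sum>j=1..m. abel_weight (2 * radius) (2 * speed) t m j * norm (\<Sum>i=1..j. w i *\<^sub>R e i))"
  proof (rule sum_inner_le_partial_sums[OF g(2)])
    show "norm (z (\<kappa> m) - q (\<kappa> m)) \<le> 2 * radius"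
      using norm_triangle_ineq4[of "z (\<kappa> m)" "q (\<kappa> m)"] z_bd[of m] q_bd[of m] g(2) by simp
    show "0 \<le> 2 * speed * (t (Suc m) - t m)"
      using w[of m] g(2) speed_nonneg by (simp add: w_def)
    fix j assume j: "1 \<le> j" "j < m"
    then have j': "j \<in> {1..m}" "Suc j \<in> {1..m}" by auto
    have \<kappa>: "\<kappa> j \<le> \<kappa> (Suc j)"
      using g(1) g(5)[OF j'(1)] g(5)[OF j'(2)] g(7)[OF j'(1)] by simp
    have "norm (z (\<kappa> (Suc j)) - z (\<kappa> j)) \<le> speed * (t (Suc j) - t j)"
      using euler_lipschitz[OF f z0 euler _ _ \<kappa> g(6)[OF j'(2)]] g(1) kh g(5)[OF j'(1)] g(5)[OF j'(2)]
      by simp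
    moreover have "norm (q (\<kappa> (Suc j)) - q (\<kappa> j)) \<le> speed * (t (Suc j) - t j)"
      using euler_lipschitz[OF fs, of q, OF _ q(2) _ _ \<kappa> g(6)[OF j'(2)]] q(1) x0 g(1) kh
        g(5)[OF j'(1)] g(5)[OF j'(2)] by simp
    moreover have "norm (z (\<kappa> (Suc j)) - q (\<kappa> (Suc j)) - (z (\<kappa> j) - q (\<kappa> j)))
        = norm ((z (\<kappa> (Suc j)) - z (\<kappa> j)) - (q (\<kappa> (Suc j)) - q (\<kappa> j)))"
      by (simp add: algebra_simps)
    ultimately show "norm (z (\<kappa> (Suc j)) - q (\<kappa> (Suc j)) - (z (\<kappa> j) - q (\<kappa> j)))
        \<le> 2 * speed * (t (Suc j) - t j)"
      using norm_triangle_ineq4[of "z (\<kappa> (Suc j)) - z (\<kappa> j)" "q (\<kappa> (Suc j)) - q (\<kappa> j)"] by linarith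
  qed
  finally show ?thesis
    by (simp add: w_def C_def)
qed

end

text \<open>Passing to the l1 norm gives scalar partial sums indexed by a time and a coordinate.
  Coordinates may be dependent, since only independence over time is used for each scalar
  sum.\<close>

lemma (in prob_space) weighted_partial_sums_tail:
  fixes X :: "nat \<Rightarrow> 'a \<Rightarrow> real^'n" and w c :: "nat \<Rightarrow> real"
  assumes indep: "indep_vars (\<lambda>_. borel) X {1..m}"
    and bound: "\<And>j. j \<in> {1..m} \<Longrightarrow> AE \<omega> in M. norm (X j \<omega>) \<le> b"
    and mean: "\<And>j. j \<in> {1..m} \<Longrightarrow> (LINT \<omega>|M. X j \<omega>) = 0"
    and c: "\<And>j. j \<in> {1..m} \<Longrightarrow> 0 \<le> c j" "0 < (\<Sum>j=1..m. c j)"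
    and v: "0 < b" "0 < (\<Sum>j=1..m. (w j)\<^sup>2)" and u: "0 < u"
  shows "outer_measure_of M {\<omega> \<in> space M. u \<le> (\<Sum>j=1..m. c j * norm (\<Sum>i=1..j. w i *\<^sub>R X i \<omega>))}
    \<le> ennreal (2 * exp (- (u\<^sup>2 / (2 * (real CARD('n) * (\<Sum>j=1..m. c j))\<^sup>2 * (b\<^sup>2 * (\<Sum>j=1..m. (w j)\<^sup>2))))))"
proof -
  define V where "V = (\<lambda>(j, n) \<omega>. \<bar>\<Sum>i=1..j. w i * X i \<omega> $ n\<bar>)"
  define I where "I = {1..m} \<times> (UNIV :: 'n set)"
  define v where "v = b\<^sup>2 * (\<Sum>j=1..m. (w j)\<^sup>2)"
  have X [measurable]: "random_variable borel (X j)" if "j \<in> {1..m}" for j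
    using indep that by (simp add: indep_vars_def)
  have V [measurable]: "random_variable borel (V p)" if "p \<in> I" for p
  proof -
    have "random_variable borel (\<lambda>\<omega>. X i \<omega> $ snd p)" if "i \<in> {1..fst p}" for i
      using X[of i] that \<open>p \<in> I\<close>
      by (intro borel_measurable_continuous_on[where f = "\<lambda>y. y $ snd p"])
        (auto simp: I_def intro!: continuous_intros)
    then have "random_variable borel (\<lambda>\<omega>. \<bar>\<Sum>i=1..fst p. w i * X i \<omega> $ snd p\<bar>)"
      by measurable
    then show ?thesis
      by (simp add: V_def case_prod_unfold)
  qed
  have mgf: "(\<integral>\<^sup>+\<omega>. ennreal (exp (s * V p \<omega>)) \<partial>M) \<le> ennreal (2 * exp (s\<^sup>2 * v / 2))"
    if p: "p \<in> I" and s: "0 < s" for p s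
  proof -
    obtain j n where jn: "p = (j, n)" "j \<in> {1..m}"
      using p by (auto simp: I_def)
    then have sub: "{1..j} \<subseteq> {1..m}" by auto
    have "(\<integral>\<^sup>+\<omega>. ennreal (exp (s * \<bar>\<Sum>i=1..j. w i * X i \<omega> $ n\<bar>)) \<partial>M)
        \<le> ennreal (2 * exp (s\<^sup>2 * (\<Sum>i=1..j. (\<bar>w i\<bar> * b)\<^sup>2) / 2))"
    proof (rule hoeffding_mgf_abs[OF _ _ _ _ s])
      show "indep_vars (\<lambda>_. borel) (\<lambda>i \<omega>. w i * X i \<omega> $ n) {1..j}"
        by (rule indep_vars_compose2[OF indep_vars_subset[OF indep sub], where Y = "\<lambda>i y. w i * y $ n"])
          (intro borel_measurable_continuous_onI continuous_intros)
      fix i assume i: "i \<in> {1..j}"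
      then have i': "i \<in> {1..m}" using sub by auto
      show "AE \<omega> in M. \<bar>w i * X i \<omega> $ n\<bar> \<le> \<bar>w i\<bar> * b"
        using bound[OF i']
        by eventually_elim (auto simp: abs_mult intro!: mult_left_mono order_trans[OF component_le_norm_cart])
      have int: "integrable M (X i)"
        by (rule integrable_const_bound[OF bound[OF i'] X[OF i']])
      have "expectation (\<lambda>\<omega>. X i \<omega> $ n) = (LINT \<omega>|M. X i \<omega>) $ n"
        by (rule integral_bounded_linear[OF bounded_linear_vec_nth int])
      then show "expectation (\<lambda>\<omega>. w i * X i \<omega> $ n) = 0"
        by (simp add: mean[OF i'])
    qed simp
    \<comment> \<open>Extending the sum of squares to all times gives every partial sum the same
      variance proxy \<open>v\<close>.\<close>
    also have "\<dots> \<le> ennreal (2 * exp (s\<^sup>2 * v / 2))"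
    proof -
      have "(\<Sum>i=1..j. (\<bar>w i\<bar> * b)\<^sup>2) \<le> (\<Sum>i=1..m. (\<bar>w i\<bar> * b)\<^sup>2)"
        by (intro sum_mono2 sub) auto
      also have "\<dots> = v"
        by (simp add: v_def power_mult_distrib sum_distrib_left mult.commute)
      finally show ?thesis
        by (intro ennreal_leI) (auto intro!: mult_left_mono)
    qed
    finally show ?thesis
      by (simp add: V_def jn)
  qed
  have total: "(\<Sum>p\<in>I. c (fst p)) = real CARD('n) * (\<Sum>j=1..m. c j)"
  proof -
    have "(\<Sum>p\<in>I. c (fst p)) = (\<Sum>j=1..m. \<Sum>n\<in>(UNIV :: 'n set). c j)"
      by (simp only: sum.cartesian_product I_def case_prod_unfold)
    then show ?thesis
      by (simp add: sum_distrib_left)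
  qed
  have sub: "{\<omega> \<in> space M. u \<le> (\<Sum>j=1..m. c j * norm (\<Sum>i=1..j. w i *\<^sub>R X i \<omega>))}
      \<subseteq> {\<omega> \<in> space M. u \<le> (\<Sum>p\<in>I. c (fst p) * V p \<omega>)}"
  proof -
    have "(\<Sum>j=1..m. c j * norm (\<Sum>i=1..j. w i *\<^sub>R X i \<omega>)) \<le> (\<Sum>p\<in>I. c (fst p) * V p \<omega>)" for \<omega>
    proof -
      have "(\<Sum>j=1..m. c j * norm (\<Sum>i=1..j. w i *\<^sub>R X i \<omega>))
          \<le> (\<Sum>j=1..m. c j * (\<Sum>n\<in>UNIV. \<bar>(\<Sum>i=1..j. w i *\<^sub>R X i \<omega>) $ n\<bar>))"
        by (intro sum_mono mult_left_mono norm_le_l1_cart c(1))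
      also have "\<dots> = (\<Sum>p\<in>I. c (fst p) * V p \<omega>)"
        by (simp add: I_def V_def sum.cartesian_product sum_distrib_left case_prod_unfold)
      finally show ?thesis .
    qed
    then show ?thesis
      by (auto intro: order_trans)
  qed
  have meas: "{\<omega> \<in> space M. u \<le> (\<Sum>p\<in>I. c (fst p) * V p \<omega>)} \<in> sets M"
    by measurable
  have "outer_measure_of M {\<omega> \<in> space M. u \<le> (\<Sum>j=1..m. c j * norm (\<Sum>i=1..j. w i *\<^sub>R X i \<omega>))}
      \<le> emeasure M {\<omega> \<in> space M. u \<le> (\<Sum>p\<in>I. c (fst p) * V p \<omega>)}"
    using outer_measure_of_mono[OF sub, of M] meas by simp
  also have "\<dots> \<le> ennreal (2 * exp (- (u\<^sup>2 / (2 * (real CARD('n) * (\<Sum>j=1..m. c j))\<^sup>2 * v))))"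
    by (rule subgaussian_weighted_sum_tail[OF _ V _ total])
      (use c v u mgf in \<open>auto simp: I_def v_def\<close>)
  finally show ?thesis
    by (simp add: v_def)
qed

section \<open>Absorbing the factor 2 and assembling the constants\<close>

lemma two_exp_shifted_square_less:
  fixes \<sigma> e :: real
  assumes "0 < \<sigma>" "0 < e"
  shows "2 * exp (- (((4 * \<sigma> + e) / 2)\<^sup>2 / (2 * \<sigma>\<^sup>2))) < exp (- (e\<^sup>2 / (8 * \<sigma>\<^sup>2)))"
proof -
  \<comment> \<open>The shift by \<open>4 * \<sigma>\<close> contributes the constant 2 to the
    exponent, and \<open>2 * exp (- 2) < 1\<close>.\<close>
  have "((4 * \<sigma> + e) / 2)\<^sup>2 / (2 * \<sigma>\<^sup>2) = 2 + e / \<sigma> + e\<^sup>2 / (8 * \<sigma>\<^sup>2)"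
    using assms by (simp add: field_simps power2_eq_square)
  also have "\<dots> \<ge> 2 + e\<^sup>2 / (8 * \<sigma>\<^sup>2)"
    using assms by simp
  finally have "2 * exp (- (((4 * \<sigma> + e) / 2)\<^sup>2 / (2 * \<sigma>\<^sup>2))) \<le> 2 * exp (- (2 + e\<^sup>2 / (8 * \<sigma>\<^sup>2)))"
    by simp
  also have "\<dots> = 2 * exp (- 2) * exp (- (e\<^sup>2 / (8 * \<sigma>\<^sup>2)))"
    by (simp add: mult_exp_exp)
  also have "\<dots> < exp (- (e\<^sup>2 / (8 * \<sigma>\<^sup>2)))"
    using exp_ge_add_one_self[of 2] by (simp add: exp_minus field_simps)
  finally show ?thesis .
qed

text \<open>The constants precede all data and depend on the centre of the ball only through the
  norm bound \<open>F\<^sub>0\<close>. Outer measure is used because the minimisers are an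
  arbitrary, possibly non-measurable, selection.\<close>

theorem theorem1:
  fixes H :: "(real^'n \<Rightarrow> real^'n) set"
    and ip :: "(real^'n \<Rightarrow> real^'n) \<Rightarrow> (real^'n \<Rightarrow> real^'n) \<Rightarrow> real"
    and K :: "real^'n \<Rightarrow> real^'n \<Rightarrow> real^'n^'n"
    and T R r M\<^sub>\<epsilon> N\<^sub>K F\<^sub>0 :: real
  assumes "T > 0" and "R > 0" and "r > 0" and "M\<^sub>\<epsilon> > 0"
    and "vector_rkhs H ip K"
    and "\<forall>v. C2 (\<lambda>u. K u v)"
    and "\<forall>u v i. K u u $ i $ i - 2 * (K u v $ i $ i) + K v v $ i $ i \<le> N\<^sub>K\<^sup>2 * (norm (u - v))\<^sup>2"
  shows "\<exists>K\<^sub>1>0. \<exists>K\<^sub>2>0. \<exists>K\<^sub>3>0. \<exists>K\<^sub>4>0.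
    \<forall>f\<^sub>0\<in>H. hnorm ip f\<^sub>0 \<le> F\<^sub>0 \<longrightarrow>
    (\<forall>(xs :: real \<Rightarrow> real^'n) (h :: real) (k :: nat) (m :: nat) (\<kappa> :: nat \<Rightarrow> nat) (t :: nat \<Rightarrow> real)
      (M :: 'w measure) (\<epsilon> :: nat \<Rightarrow> 'w \<Rightarrow> real^'n)
      (z :: 'w \<Rightarrow> nat \<Rightarrow> real^'n) (f :: 'w \<Rightarrow> real^'n \<Rightarrow> real^'n).
      true_trajectory H ip f\<^sub>0 R r T xs \<longrightarrow>
      observation_grid T h k m \<kappa> t \<longrightarrow>
      bounded_noise M m M\<^sub>\<epsilon> \<epsilon> \<longrightarrow>
      (\<forall>\<omega>\<in>space M. estimate H ip f\<^sub>0 R r h k m \<kappa> t (\<lambda>j. xs (t j) + \<epsilon> j \<omega>) (z \<omega>) (f \<omega>)) \<longrightarrow>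
      (\<forall>e>0.
        outer_measure_of M {\<omega>\<in>space M.
          L2_norm_sq T (\<lambda>s. interpolate h (z \<omega>) s - xs s)
            \<ge> K\<^sub>1 * real CARD('n) * sqrt (\<Sum>j=1..m. (t (Suc j) - t j)\<^sup>2)
              + h\<^sup>2 * K\<^sub>3 * real CARD('n)
              + K\<^sub>4 * real CARD('n) * (\<Sum>j=1..m. (t (Suc j) - t j)\<^sup>2) + e}
        < ennreal (exp (- K\<^sub>2 * e\<^sup>2 / (real CARD('n) * (\<Sum>j=1..m. (t (Suc j) - t j)\<^sup>2))))))"
proof -
  interpret vector_rkhs H ip K by fact
  define d where "d = real CARD('n)"
  \<comment> \<open>By the triangle inequality this bounds the norm of every feasible field,
    including the true one.\<close>
  define F where "F = R + \<bar>F\<^sub>0\<bar>"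
  define A where "A = F * (\<Sum>i\<in>UNIV. hnorm ip (kernel_section 0 i))"
  \<comment> \<open>The added 1 keeps \<open>B\<close>, hence \<open>speed\<close> and the final
    constants, strictly positive even when \<open>N\<^sub>K = 0\<close>.\<close>
  define B where "B = d * \<bar>N\<^sub>K\<bar> * F + 1"
  have d: "0 < d" and F: "0 \<le> F" and B: "0 < B"
    using \<open>R > 0\<close> by (auto simp: d_def F_def B_def add_nonneg_pos)
  interpret lipschitz_fields A B r T
    using F B \<open>r > 0\<close> \<open>T > 0\<close>
    by unfold_locales (auto simp: A_def intro!: mult_nonneg_nonneg sum_nonneg hnorm_nonneg kernel_section_mem)
  have speed: "0 < speed"
    using A_nonneg B radius_pos by (simp add: speed_def add_nonneg_pos)
  have adm: "admissible g"
    if f\<^sub>0: "f\<^sub>0 \<in> H" "hnorm ip f\<^sub>0 \<le> F\<^sub>0" and g: "g \<in> H" "hnorm ip (\<lambda>u. g u - f\<^sub>0 u) \<le> R" for f\<^sub>0 g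
  proof -
    have gF: "hnorm ip g \<le> F"
      using hnorm_triangle_diff[OF g(1) f\<^sub>0(1)] f\<^sub>0(2) g(2) by (simp add: F_def)
    have "norm (g 0) \<le> A"
      unfolding A_def
      by (rule order_trans[OF norm_eval_le[OF g(1)] mult_right_mono[OF gF]])
        (auto intro!: sum_nonneg hnorm_nonneg kernel_section_mem)
    moreover have "norm (g x - g y) \<le> B * norm (x - y)" for x y
    proof -
      have "norm (g x - g y) \<le> d * \<bar>N\<^sub>K\<bar> * hnorm ip g * norm (x - y)"
        unfolding d_def using assms(7) by (intro norm_diff_le g(1)) blast
      also have "\<dots> \<le> B * norm (x - y)"
        unfolding B_def using gF d
        by (intro mult_right_mono add_increasing2 mult_left_mono) auto
      finally show ?thesis .
    qed
    ultimately show ?thesis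
      by (simp add: admissible_def)
  qed
  \<comment> \<open>The dimension times the total Abel weight for \<open>D = 2 * radius\<close> and
    \<open>L = 2 * speed\<close>.\<close>
  define Q where "Q = d * (2 * speed * T + 2 * radius)"
  define C where "C = 8 * speed * radius + 4 * speed\<^sup>2 * T"
  define K\<^sub>1 where "K\<^sub>1 = 4 * Q * M\<^sub>\<epsilon> / d"
  define K\<^sub>2 where "K\<^sub>2 = d / (8 * (Q * M\<^sub>\<epsilon>)\<^sup>2)"
  define K\<^sub>3 where "K\<^sub>3 = T * (speed * exp (B * T))\<^sup>2 / d"
  define K\<^sub>4 where "K\<^sub>4 = C / d"
  have Q: "0 < Q"
    using d speed radius_pos \<open>T > 0\<close> by (simp add: Q_def add_pos_pos)
  have C: "0 < C"
    using speed radius_pos \<open>T > 0\<close> by (simp add: C_def add_pos_pos)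
  have K: "0 < K\<^sub>1" "0 < K\<^sub>2" "0 < K\<^sub>3" "0 < K\<^sub>4"
    using Q C d speed \<open>M\<^sub>\<epsilon> > 0\<close> \<open>T > 0\<close> by (simp_all add: K\<^sub>1_def K\<^sub>2_def K\<^sub>3_def K\<^sub>4_def)
  have "outer_measure_of M {\<omega>\<in>space M.
      L2_norm_sq T (\<lambda>s. interpolate h (z \<omega>) s - xs s)
        \<ge> K\<^sub>1 * d * sqrt (\<Sum>j=1..m. (t (Suc j) - t j)\<^sup>2) + h\<^sup>2 * K\<^sub>3 * d
          + K\<^sub>4 * d * (\<Sum>j=1..m. (t (Suc j) - t j)\<^sup>2) + e}
      < ennreal (exp (- K\<^sub>2 * e\<^sup>2 / (d * (\<Sum>j=1..m. (t (Suc j) - t j)\<^sup>2))))"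
    if f\<^sub>0: "f\<^sub>0 \<in> H" "hnorm ip f\<^sub>0 \<le> F\<^sub>0" and traj: "true_trajectory H ip f\<^sub>0 R r T xs"
      and grid: "observation_grid T h k m \<kappa> t" and noise: "bounded_noise M m M\<^sub>\<epsilon> \<epsilon>"
      and est: "\<forall>\<omega>\<in>space M. estimate H ip f\<^sub>0 R r h k m \<kappa> t (\<lambda>j. xs (t j) + \<epsilon> j \<omega>) (z \<omega>) (f \<omega>)"
      and e: "0 < e"
    for f\<^sub>0 xs h k m \<kappa> t and M :: "'w measure" and \<epsilon> z f e
  proof -
    note g = observation_grid_facts[OF grid \<open>T > 0\<close>]
    obtain fs where fs: "fs \<in> H" "hnorm ip (\<lambda>u. fs u - f\<^sub>0 u) \<le> R" and x0: "norm (xs 0) \<le> r"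
      and ode: "\<And>s. s \<in> {0..T} \<Longrightarrow> (xs has_vector_derivative fs (xs s)) (at s within {0..T})"
      using traj by (auto simp: true_trajectory_def)
    interpret prob_space M
      using noise by (simp add: bounded_noise_def)
    define S where "S = (\<Sum>j=1..m. (t (Suc j) - t j)\<^sup>2)"
    define c where "c = abel_weight (2 * radius) (2 * speed) t m"
    define Y where "Y = (\<lambda>\<omega>. \<Sum>j=1..m. c j * norm (\<Sum>i=1..j. (t (Suc i) - t i) *\<^sub>R \<epsilon> i \<omega>))"
    \<comment> \<open>The subgaussian scale of \<open>Y\<close>; \<open>K\<^sub>1\<close> and
      \<open>K\<^sub>2\<close> are chosen so that
      \<open>K\<^sub>1 * d * sqrt S = 4 * \<sigma>\<close> and
      \<open>K\<^sub>2 / (d * S) = 1 / (8 * \<sigma>\<^sup>2)\<close>.\<close>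
    define \<sigma> where "\<sigma> = Q * M\<^sub>\<epsilon> * sqrt S"
    have S: "0 < S"
    proof -
      have "S \<noteq> 0"
      proof
        \<comment> \<open>All gaps would then vanish, although they add up to
          \<open>T > 0\<close>.\<close>
        assume "S = 0"
        then have "(\<Sum>j=1..m. t (Suc j) - t j) = 0"
          unfolding S_def by (simp add: sum_nonneg_eq_0_iff)
        then show False
          using g(2-4) \<open>T > 0\<close> by (simp add: sum_Suc_diff)
      qed
      moreover have "0 \<le> S"
        unfolding S_def by (intro sum_nonneg) auto
      ultimately show ?thesis by simp
    qed
    have \<sigma>: "0 < \<sigma>" "\<sigma>\<^sup>2 = (Q * M\<^sub>\<epsilon>)\<^sup>2 * S"
      using S Q \<open>M\<^sub>\<epsilon> > 0\<close> by (simp_all add: \<sigma>_def power_mult_distrib)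
    have c_nonneg: "0 \<le> c j" if "j \<in> {1..m}" for j
      using g(7)[OF that] speed radius_pos by (simp add: c_def abel_weight_def)
    have c_sum: "d * (\<Sum>j=1..m. c j) = Q"
      unfolding c_def sum_abel_weight[OF g(2)] g(3,4) by (simp add: Q_def)
    have c_pos: "0 < (\<Sum>j=1..m. c j)"
      using c_sum Q d by (metis zero_less_mult_pos)
    have error: "L2_norm_sq T (\<lambda>s. interpolate h (z \<omega>) s - xs s) \<le> h\<^sup>2 * K\<^sub>3 * d + K\<^sub>4 * d * S + 2 * Y \<omega>"
      if \<omega>: "\<omega> \<in> space M" for \<omega>
    proof -
      have feas: "feasible H ip f\<^sub>0 R r h k (z \<omega>) (f \<omega>)"
        and opt: "\<And>q p. feasible H ip f\<^sub>0 R r h k q p \<Longrightarrow>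
          loss m \<kappa> t (\<lambda>j. xs (t j) + \<epsilon> j \<omega>) (z \<omega>) \<le> loss m \<kappa> t (\<lambda>j. xs (t j) + \<epsilon> j \<omega>) q"
        using bspec[OF est \<omega>] unfolding estimate_def is_arg_min_linorder by auto
      have "L2_norm_sq T (\<lambda>s. interpolate h (z \<omega>) s - xs s)
          \<le> T * (h * speed * exp (B * T))\<^sup>2 + C * S + 2 * Y \<omega>"
        unfolding C_def S_def Y_def c_def
      proof (rule estimation_error_le[OF \<open>T > 0\<close> grid adm[OF f\<^sub>0 fs] x0 ode])
        show "admissible (f \<omega>)" "norm (z \<omega> 0) \<le> r"
          using feas adm[OF f\<^sub>0] by (auto simp: feasible_def)
        show "z \<omega> (Suc l) = z \<omega> l + h *\<^sub>R f \<omega> (z \<omega> l)" if "l < k" for l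
          using feas that by (auto simp: feasible_def)
        show "loss m \<kappa> t (\<lambda>j. xs (t j) + \<epsilon> j \<omega>) (z \<omega>) \<le> loss m \<kappa> t (\<lambda>j. xs (t j) + \<epsilon> j \<omega>) q"
          if "q 0 = xs 0" "\<And>l. q (Suc l) = q l + h *\<^sub>R fs (q l)" for q
          \<comment> \<open>The pair \<open>(q, fs)\<close> is feasible, so the minimiser can be
            compared with it.\<close>
          using that fs x0 by (intro opt[of q fs]) (simp add: feasible_def)
      qed
      then show ?thesis
        using d by (simp add: K\<^sub>3_def K\<^sub>4_def power_mult_distrib mult_ac)
    qed
    have "outer_measure_of M {\<omega>\<in>space M.
          L2_norm_sq T (\<lambda>s. interpolate h (z \<omega>) s - xs s)
            \<ge> K\<^sub>1 * d * sqrt S + h\<^sup>2 * K\<^sub>3 * d + K\<^sub>4 * d * S + e}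
        \<le> outer_measure_of M {\<omega>\<in>space M. (4 * \<sigma> + e) / 2 \<le> Y \<omega>}"
    \<comment> \<open>The threshold is halved because \<open>Y\<close> enters the error bound with
      factor 2.\<close>
    proof (rule outer_measure_of_mono, safe)
      fix \<omega> assume \<omega>: "\<omega> \<in> space M"
        and large: "K\<^sub>1 * d * sqrt S + h\<^sup>2 * K\<^sub>3 * d + K\<^sub>4 * d * S + e
          \<le> L2_norm_sq T (\<lambda>s. interpolate h (z \<omega>) s - xs s)"
      have "K\<^sub>1 * d * sqrt S = 4 * \<sigma>"
        using d by (simp add: K\<^sub>1_def \<sigma>_def)
      then show "(4 * \<sigma> + e) / 2 \<le> Y \<omega>"
        using order_trans[OF large error[OF \<omega>]] by simp
    qed
    also have "\<dots> \<le> ennreal (2 * exp (- (((4 * \<sigma> + e) / 2)\<^sup>2 /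
        (2 * (d * (\<Sum>j=1..m. c j))\<^sup>2 * (M\<^sub>\<epsilon>\<^sup>2 * S)))))"
      unfolding Y_def S_def d_def
    proof (rule weighted_partial_sums_tail[OF _ _ _ c_nonneg c_pos \<open>M\<^sub>\<epsilon> > 0\<close> S[unfolded S_def]])
      show "0 < (4 * \<sigma> + e) / 2"
        using \<sigma> e by simp
    qed (use noise in \<open>auto simp: bounded_noise_def\<close>)
    also have "2 * (d * (\<Sum>j=1..m. c j))\<^sup>2 * (M\<^sub>\<epsilon>\<^sup>2 * S) = 2 * \<sigma>\<^sup>2"
      unfolding c_sum \<sigma>(2) by (simp add: power_mult_distrib)
    also have "ennreal (2 * exp (- (((4 * \<sigma> + e) / 2)\<^sup>2 / (2 * \<sigma>\<^sup>2)))) < ennreal (exp (- (e\<^sup>2 / (8 * \<sigma>\<^sup>2))))"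
      by (intro ennreal_lessI two_exp_shifted_square_less \<sigma> e) simp
    also have "- (e\<^sup>2 / (8 * \<sigma>\<^sup>2)) = - K\<^sub>2 * e\<^sup>2 / (d * S)"
      using d by (simp add: K\<^sub>2_def \<sigma>(2))
    finally show ?thesis
      unfolding S_def .
  qed
  note bound = this[unfolded d_def]
  show ?thesis
  proof (rule exI[of _ K\<^sub>1], rule conjI[OF K(1)], rule exI[of _ K\<^sub>2], rule conjI[OF K(2)],
      rule exI[of _ K\<^sub>3], rule conjI[OF K(3)], rule exI[of _ K\<^sub>4], rule conjI[OF K(4)],
      intro ballI allI impI)
  qed (rule bound; assumption)
qed

end
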